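(* Fix an integer $m\ge1$, $a\in\left(0,\frac{m}{m+2}\right)$, and let $j_n=\lfloor n^a\rfloor$. Given $\sigma\in(0,1)$, there exists a unique root $z(\sigma)\in(1,\infty)$ of the equation $$(1-\sigma)^{-1/2}-1=\varphi(z),\qquad \varphi(z):=(z\log z+1-z)^{-1},$$ and $z(\sigma)\sim 2\bigl(\sigma\log(1/\sigma)\bigr)^{-1}$ as $\sigma\to0$. If $z>z(\sigma)$, then $$\lim_{n\to\infty}\mathbb P\Bigl(D(j)\le z\bigl((n/j)^{1/2}-1\bigr)\log n\ \text{ for all } j\in[j_n,(1-\sigma)n]\Bigr)=1,$$ where $D(j)$ is the degree of vertex $j$ in $G_m^n$.
   Context: Bollobás–Riordan preferential attachment multigraph $G_m^n$. Let $w_1,\dots,w_{mn+1}$ be independent exponential random variables with mean $1$, $W_k=\sum_{i=1}^k w_i$, $W_0=0$. Put $R_k=W_k/W_{mn+1}$ for $k=1,\dots,mn$, $R_0=0$. Conditionally on $\mathbf W=\{W_k\}$, let $\ell_1,\dots,\ell_{mn}$ be independent, $\ell_k$ having density $\frac{1}{2\sqrt{R_k x}}$ on $(0,R_k]$. The vertex set of $G_m^n$ is $[n]$; vertex $j$ is identified with the interval $(R_{m(j-1)},R_{mj}]$. For each $k\in[mn]$ there is one edge joining the vertex containing $R_k$ with the vertex containing $\ell_k$ (a loop if these coincide). A loop contributes $2$ to the degree of its vertex. *)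

theory Defs
  imports
    "HOL-Probability.Probability"
    "HOL-Library.Multiset"
    "HOL-Library.Landau_Symbols"
begin

text \<open>
  A sample point is a pair \<open>(w, l)\<close> with \<open>w\<close> indexed by \<open>{1..m*n+1}\<close> and \<open>l\<close> by \<open>{1..m*n}\<close>.
\<close>

definition pa_W :: "(nat \<Rightarrow> real) \<Rightarrow> nat \<Rightarrow> real" where
  "pa_W w k = (\<Sum>i=1..k. w i)"

definition pa_R :: "nat \<Rightarrow> nat \<Rightarrow> (nat \<Rightarrow> real) \<Rightarrow> nat \<Rightarrow> real" where
  "pa_R m n w k = pa_W w k / pa_W w (m * n + 1)"

definition pa_end_density :: "real \<Rightarrow> real \<Rightarrow> real" where
  "pa_end_density r x = (if 0 < x \<and> x \<le> r then 1 / (2 * sqrt (r * x)) else 0)"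

abbreviation pa_w_space :: "nat \<Rightarrow> nat \<Rightarrow> (nat \<Rightarrow> real) measure" where
  "pa_w_space m n \<equiv> \<Pi>\<^sub>M i\<in>{1..m * n + 1}. borel"

abbreviation pa_l_space :: "nat \<Rightarrow> nat \<Rightarrow> (nat \<Rightarrow> real) measure" where
  "pa_l_space m n \<equiv> \<Pi>\<^sub>M k\<in>{1..m * n}. borel"

definition pa_w_law :: "nat \<Rightarrow> nat \<Rightarrow> (nat \<Rightarrow> real) measure" where
  "pa_w_law m n = (\<Pi>\<^sub>M i\<in>{1..m * n + 1}. density lborel (exponential_density 1))"

definition pa_l_law :: "nat \<Rightarrow> nat \<Rightarrow> (nat \<Rightarrow> real) \<Rightarrow> (nat \<Rightarrow> real) measure" where
  "pa_l_law m n w = (\<Pi>\<^sub>M k\<in>{1..m * n}. density lborel (pa_end_density (pa_R m n w k)))"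

text \<open>
  Conditioning on \<open>W\<close> and conditioning on \<open>w\<close> agree, since each sequence determines the other.
  On the null set where some \<open>w i\<close> fails to be positive, \<open>pa_l_law\<close> may be a strict
  sub-probability measure; \<open>prob_space_pa_space\<close> below shows that this does no harm.
\<close>

definition pa_space :: "nat \<Rightarrow> nat \<Rightarrow> ((nat \<Rightarrow> real) \<times> (nat \<Rightarrow> real)) measure" where
  "pa_space m n =
     do {
       w \<leftarrow> pa_w_law m n;
       l \<leftarrow> pa_l_law m n w;
       return (pa_w_space m n \<Otimes>\<^sub>M pa_l_space m n) (w, l)
     }"

definition pa_interval :: "nat \<Rightarrow> nat \<Rightarrow> (nat \<Rightarrow> real) \<Rightarrow> nat \<Rightarrow> real set" where
  "pa_interval m n w j = {pa_R m n w (m * (j - 1)) <.. pa_R m n w (m * j)}"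

definition pa_vertex :: "nat \<Rightarrow> nat \<Rightarrow> (nat \<Rightarrow> real) \<Rightarrow> real \<Rightarrow> nat" where
  "pa_vertex m n w x = (THE j. j \<in> {1..n} \<and> x \<in> pa_interval m n w j)"

text \<open>
  A multigraph is given by the multiset of its edges, and an edge by the two-element multiset of
  its endpoints, so that a loop at \<open>v\<close> is \<open>{#v, v#}\<close> and contributes 2 to the degree of \<open>v\<close>.
\<close>

definition pa_graph :: "nat \<Rightarrow> nat \<Rightarrow> (nat \<Rightarrow> real) \<Rightarrow> (nat \<Rightarrow> real) \<Rightarrow> nat multiset multiset" where
  "pa_graph m n w l =
     {# {# pa_vertex m n w (pa_R m n w k), pa_vertex m n w (l k) #}. k \<in># mset_set {1..m * n} #}"

definition mg_degree :: "'v multiset multiset \<Rightarrow> 'v \<Rightarrow> nat" where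
  "mg_degree G v = (\<Sum>e\<in>#G. count e v)"

definition pa_phi :: "real \<Rightarrow> real" where
  "pa_phi z = inverse (z * ln z + 1 - z)"

definition pa_is_root :: "real \<Rightarrow> real \<Rightarrow> bool" where
  "pa_is_root \<sigma> z \<longleftrightarrow> z \<in> {1<..} \<and> (1 - \<sigma>) powr (-1/2) - 1 = pa_phi z"

definition pa_root :: "real \<Rightarrow> real" where
  "pa_root \<sigma> = (THE z. pa_is_root \<sigma> z)"


subsection \<open>Well-definedness of the probability space\<close>

lemma pa_end_density_nonneg: "0 \<le> pa_end_density r x"
  by (auto simp: pa_end_density_def)

lemma pa_end_density_measurable [measurable]:
  "case_prod pa_end_density \<in> borel_measurable (borel \<Otimes>\<^sub>M borel)"
  unfolding pa_end_density_def by measurable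

lemma pa_end_density_measurable' [measurable]:
  "pa_end_density r \<in> borel_measurable borel"
  unfolding pa_end_density_def by measurable

lemma pa_end_density_integral:
  assumes "r > 0"
  shows "(\<integral>\<^sup>+x. ennreal (pa_end_density r x) \<partial>lborel) = 1"
proof -
  have "((\<lambda>x. 1 / (2 * sqrt (r * x))) has_integral (sqrt (r / r) - sqrt (0 / r))) {0..r}"
  proof (rule fundamental_theorem_of_calculus_interior)
    show "continuous_on {0..r} (\<lambda>x. sqrt (x / r))"
      using assms by (intro continuous_intros) auto
    show "((\<lambda>x. sqrt (x / r)) has_vector_derivative 1 / (2 * sqrt (r * x))) (at x)"
      if "x \<in> {0<..<r}" for x
    proof -
      have "((\<lambda>x. sqrt (x / r)) has_real_derivative (1 / r) * (inverse (sqrt (x / r)) / 2)) (at x)"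
        using that assms
        by (auto intro!: derivative_eq_intros simp: divide_less_0_iff)
      moreover have "(1 / r) * (inverse (sqrt (x / r)) / 2) = 1 / (2 * sqrt (r * x))"
      proof -
        have "r = sqrt r * sqrt r" using assms by simp
        thus ?thesis using that assms
          by (simp add: real_sqrt_divide real_sqrt_mult field_simps)
      qed
      ultimately show ?thesis
        by (simp add: has_real_derivative_iff_has_vector_derivative)
    qed
  qed (use assms in auto)
  hence "((\<lambda>x. 1 / (2 * sqrt (r * x))) has_integral 1) {0..r}"
    using assms by simp
  hence "(pa_end_density r has_integral 1) {0..r}"
    by (rule has_integral_spike_finite[of "{0}", rotated 2]) (auto simp: pa_end_density_def)
  hence "(pa_end_density r has_integral 1) UNIV"
    by (rule has_integral_on_superset) (auto simp: pa_end_density_def)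
  from nn_integral_has_integral_lborel[OF _ pa_end_density_nonneg this]
  show ?thesis by simp
qed

lemma pa_end_density_zero: "r \<le> 0 \<Longrightarrow> pa_end_density r x = 0"
  by (auto simp: pa_end_density_def)

lemma prob_space_pa_end_density:
  "r > 0 \<Longrightarrow> prob_space (density lborel (pa_end_density r))"
  by (rule prob_spaceI) (simp add: emeasure_density pa_end_density_integral)

lemma emeasure_pa_end_density_le:
  "emeasure (density lborel (pa_end_density r)) A \<le> 1"
proof -
  have "emeasure (density lborel (pa_end_density r)) A
      \<le> emeasure (density lborel (pa_end_density r)) UNIV"
    by (intro emeasure_mono) auto
  also have "\<dots> \<le> 1"
    by (cases "r > 0") (simp_all add: emeasure_density pa_end_density_integral pa_end_density_zero)
  finally show ?thesis .
qed

lemma sets_pa_w_law [measurable_cong, simp]: "sets (pa_w_law m n) = sets (pa_w_space m n)"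
  unfolding pa_w_law_def by (intro sets_PiM_cong) auto

lemma sets_pa_l_law [measurable_cong, simp]: "sets (pa_l_law m n w) = sets (pa_l_space m n)"
  unfolding pa_l_law_def by (intro sets_PiM_cong) auto

lemma pa_W_measurable [measurable]:
  "k \<le> m * n + 1 \<Longrightarrow> (\<lambda>w. pa_W w k) \<in> borel_measurable (pa_w_space m n)"
  unfolding pa_W_def by (intro borel_measurable_sum measurable_component_singleton) auto

lemma pa_R_measurable [measurable]:
  "k \<le> m * n + 1 \<Longrightarrow> (\<lambda>w. pa_R m n w k) \<in> borel_measurable (pa_w_space m n)"
  unfolding pa_R_def by measurable

lemma emeasure_pa_l_law:
  assumes "\<And>k. k \<in> {1..m * n} \<Longrightarrow> A k \<in> sets borel"
  shows "emeasure (pa_l_law m n w) (Pi\<^sub>E {1..m * n} A) =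
           (\<Prod>k\<in>{1..m * n}. emeasure (density lborel (pa_end_density (pa_R m n w k))) (A k))"
proof -
  interpret product_sigma_finite "\<lambda>k. density lborel (pa_end_density (pa_R m n w k))"
  proof (unfold product_sigma_finite_def, intro allI)
    fix k
    have "finite_measure (density lborel (pa_end_density (pa_R m n w k)))"
      by (rule finite_measureI) (use emeasure_pa_end_density_le[of "pa_R m n w k" UNIV] in
        \<open>auto simp: top_unique\<close>)
    thus "sigma_finite_measure (density lborel (pa_end_density (pa_R m n w k)))"
      by (rule finite_measure.sigma_finite_measure)
  qed
  show ?thesis
    unfolding pa_l_law_def using assms by (intro emeasure_PiM) auto
qed

lemma space_pa_l_law: "space (pa_l_law m n w) = Pi\<^sub>E {1..m * n} (\<lambda>_. UNIV)"
  by (simp add: pa_l_law_def space_PiM)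

lemma subprob_space_pa_l_law: "subprob_space (pa_l_law m n w)"
proof (rule subprob_spaceI)
  show "emeasure (pa_l_law m n w) (space (pa_l_law m n w)) \<le> 1"
    unfolding space_pa_l_law
    by (subst emeasure_pa_l_law) (auto intro!: prod_le_1 emeasure_pa_end_density_le)
  show "space (pa_l_law m n w) \<noteq> {}"
    by (simp add: space_pa_l_law PiE_eq_empty_iff)
qed

lemma pa_l_law_measurable [measurable]:
  "pa_l_law m n \<in> measurable (pa_w_space m n) (subprob_algebra (pa_l_space m n))"
proof (rule measurable_subprob_algebra_generated)
  let ?G = "{Pi\<^sub>E {1..m * n} E | E. \<forall>i\<in>{1..m * n}. E i \<in> sets (borel :: real measure)}"
  show "sets (pa_l_space m n) = sigma_sets (Pi\<^sub>E {1..m * n} (\<lambda>_. UNIV)) ?G"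
    unfolding sets_PiM by (subst prod_algebra_eq_finite) (auto simp: Pi_iff)
  show "Int_stable ?G"
    by (rule Int_stable_PiE)
  show "?G \<subseteq> Pow (Pi\<^sub>E {1..m * n} (\<lambda>_. UNIV))"
    by (auto simp: PiE_def)
  have *: "(\<lambda>w. emeasure (pa_l_law m n w) (Pi\<^sub>E {1..m * n} E)) \<in> borel_measurable (pa_w_space m n)"
    if E: "\<forall>i\<in>{1..m * n}. E i \<in> sets (borel :: real measure)" for E
  proof -
    have "(\<lambda>w. emeasure (density lborel (pa_end_density (pa_R m n w k))) (E k))
            \<in> borel_measurable (pa_w_space m n)" if "k \<in> {1..m * n}" for k
    proof -
      have [measurable]: "E k \<in> sets borel" "(\<lambda>w. pa_R m n w k) \<in> borel_measurable (pa_w_space m n)"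
        using E that by (auto intro!: pa_R_measurable simp del: One_nat_def)
      have "(\<lambda>w. \<integral>\<^sup>+x. ennreal (pa_end_density (pa_R m n w k) x) * indicator (E k) x \<partial>lborel)
              \<in> borel_measurable (pa_w_space m n)"
        by measurable
      thus ?thesis by (simp add: emeasure_density)
    qed
    thus ?thesis using E
      by (subst emeasure_pa_l_law) (auto intro!: borel_measurable_prod_ennreal)
  qed
  show "(\<lambda>w. emeasure (pa_l_law m n w) A) \<in> borel_measurable (pa_w_space m n)" if "A \<in> ?G" for A
    using that * by auto
  show "(\<lambda>w. emeasure (pa_l_law m n w) (Pi\<^sub>E {1..m * n} (\<lambda>_. UNIV)))
          \<in> borel_measurable (pa_w_space m n)"
    by (rule *) auto
qed (simp_all add: subprob_space_pa_l_law)

lemma prob_space_pa_w_law: "prob_space (pa_w_law m n)"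
  unfolding pa_w_law_def by (intro prob_space_PiM prob_space_exponential_density) simp

lemma AE_pa_w_law_pos: "AE w in pa_w_law m n. \<forall>i\<in>{1..m * n + 1}. 0 < w i"
proof -
  have "AE x in density lborel (exponential_density 1). (0::real) < x"
  proof -
    have "AE x in lborel. x \<noteq> (0::real)"
      by (rule AE_lborel_singleton)
    thus ?thesis
      by (subst AE_density) (auto simp: erlang_density_def)
  qed
  thus ?thesis
    unfolding pa_w_law_def
    by (intro eventually_ball_finite ballI AE_PiM_component prob_space_exponential_density) auto
qed

lemma pa_kernel_measurable [measurable]:
  "(\<lambda>w. pa_l_law m n w \<bind> (\<lambda>l. return (pa_w_space m n \<Otimes>\<^sub>M pa_l_space m n) (w, l)))
     \<in> measurable (pa_w_space m n) (subprob_algebra (pa_w_space m n \<Otimes>\<^sub>M pa_l_space m n))"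
  by measurable

lemma prob_space_pa_space: "prob_space (pa_space m n)"
proof -
  interpret prob_space "pa_w_law m n" by (rule prob_space_pa_w_law)
  show ?thesis
    unfolding pa_space_def
  proof (rule prob_space_bind)
    show "(\<lambda>w. pa_l_law m n w \<bind> (\<lambda>l. return (pa_w_space m n \<Otimes>\<^sub>M pa_l_space m n) (w, l)))
       \<in> measurable (pa_w_law m n) (subprob_algebra (pa_w_space m n \<Otimes>\<^sub>M pa_l_space m n))"
      by measurable
    show "AE w in pa_w_law m n. prob_space
       (pa_l_law m n w \<bind> (\<lambda>l. return (pa_w_space m n \<Otimes>\<^sub>M pa_l_space m n) (w, l)))"
      using AE_pa_w_law_pos[of m n] AE_space
    proof eventually_elim
      case (elim w)
      have "pa_R m n w k > 0" if "k \<in> {1..m * n}" for k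
        unfolding pa_R_def pa_W_def using that elim
        by (intro divide_pos_pos sum_pos) auto
      hence l: "prob_space (pa_l_law m n w)"
        by (intro prob_spaceI, unfold space_pa_l_law, subst emeasure_pa_l_law)
           (auto intro!: prod.neutral simp: emeasure_density pa_end_density_integral)
      have w: "w \<in> space (pa_w_space m n)"
        using elim(2) sets_eq_imp_space_eq[OF sets_pa_w_law] by metis
      show ?case
      proof (rule prob_space.prob_space_bind[OF l])
        show "AE x in pa_l_law m n w. prob_space (return (pa_w_space m n \<Otimes>\<^sub>M pa_l_space m n) (w, x))"
          using w sets_eq_imp_space_eq[OF sets_pa_l_law, of m n w]
          by (intro AE_I2 prob_space_return) (auto simp: space_pair_measure)
        show "(\<lambda>l. return (pa_w_space m n \<Otimes>\<^sub>M pa_l_space m n) (w, l)) \<in>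
          measurable (pa_l_law m n w) (subprob_algebra (pa_w_space m n \<Otimes>\<^sub>M pa_l_space m n))"
          using w by measurable
      qed
    qed
  qed
qed

lemma sets_pa_space [measurable_cong, simp]:
  "sets (pa_space m n) = sets (pa_w_space m n \<Otimes>\<^sub>M pa_l_space m n)"
proof -
  interpret prob_space "pa_w_law m n" by (rule prob_space_pa_w_law)
  show ?thesis
    unfolding pa_space_def
    by (rule sets_bind[OF sets_kernel[OF pa_kernel_measurable]])
       (use not_empty sets_eq_imp_space_eq[OF sets_pa_w_law] in auto)
qed

lemma pa_vertex_measurable [measurable]:
  assumes [measurable]: "f \<in> borel_measurable (pa_w_space m n \<Otimes>\<^sub>M pa_l_space m n)"
  shows "(\<lambda>\<omega>. pa_vertex m n (fst \<omega>) (f \<omega>))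
           \<in> measurable (pa_w_space m n \<Otimes>\<^sub>M pa_l_space m n) (count_space UNIV)"
proof -
  let ?M = "pa_w_space m n \<Otimes>\<^sub>M pa_l_space m n"
  define S where "S = (\<lambda>\<omega>. {j \<in> {1..n}. f \<omega> \<in> pa_interval m n (fst \<omega>) j})"
  have R: "(\<lambda>\<omega>. pa_R m n (fst \<omega>) k) \<in> borel_measurable ?M" if "k \<le> m * n + 1" for k
    by (rule measurable_compose[OF measurable_fst pa_R_measurable[OF that]])
  have P: "{\<omega> \<in> space ?M. f \<omega> \<in> pa_interval m n (fst \<omega>) j} \<in> sets ?M" if "j \<in> {1..n}" for j
  proof -
    have "m * (j - 1) \<le> m * n + 1" "m * j \<le> m * n + 1"
      using that by (auto intro!: le_SucI mult_le_mono2)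
    note [measurable] = this[THEN R]
    show ?thesis unfolding pa_interval_def greaterThanAtMost_iff by measurable
  qed
  have "S \<in> measurable ?M (count_space (Pow {1..n}))"
  proof (subst measurable_count_space_eq2, simp, intro conjI ballI)
    show "S \<in> space ?M \<rightarrow> Pow {1..n}" by (auto simp: S_def)
    fix T assume T: "T \<in> Pow {1..n}"
    have "S -` {T} \<inter> space ?M = {\<omega> \<in> space ?M. \<forall>j\<in>{1..n}.
            (f \<omega> \<in> pa_interval m n (fst \<omega>) j) = (j \<in> T)}"
      using T unfolding S_def Pow_iff by blast
    also have "\<dots> \<in> sets ?M"
    proof (rule sets.sets_Collect_finite_All)
      fix j assume "j \<in> {1..n}"
      note [measurable] = P[OF this]
      show "{\<omega> \<in> space ?M. (f \<omega> \<in> pa_interval m n (fst \<omega>) j) = (j \<in> T)} \<in> sets ?M"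
        by (cases "j \<in> T") (simp_all add: P[OF \<open>j \<in> {1..n}\<close>, simplified] sets.sets_Collect_neg)
    qed simp
    finally show "S -` {T} \<inter> space ?M \<in> sets ?M" .
  qed
  hence "(\<lambda>\<omega>. (\<lambda>T. THE j. j \<in> T) (S \<omega>)) \<in> measurable ?M (count_space UNIV)"
    by (rule measurable_compose) simp
  thus ?thesis
    by (simp add: S_def pa_vertex_def)
qed

lemma mg_degree_pa_graph:
  "mg_degree (pa_graph m n w l) j =
     (\<Sum>k\<in>{1..m * n}. of_bool (pa_vertex m n w (pa_R m n w k) = j) + of_bool (pa_vertex m n w (l k) = j))"
  unfolding mg_degree_def pa_graph_def
  by (simp add: image_mset.compositionality o_def sum_unfold_sum_mset[symmetric])
     (auto intro!: sum.cong)

lemma mg_degree_pa_graph_measurable [measurable]: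
  "(\<lambda>\<omega>. mg_degree (pa_graph m n (fst \<omega>) (snd \<omega>)) j) \<in> measurable (pa_space m n) (count_space UNIV)"
proof -
  let ?M = "pa_w_space m n \<Otimes>\<^sub>M pa_l_space m n"
  have "(\<lambda>\<omega>. mg_degree (pa_graph m n (fst \<omega>) (snd \<omega>)) j) \<in> measurable ?M (count_space UNIV)"
    unfolding mg_degree_pa_graph
  proof (rule measurable_sum_nat)
    fix k assume k: "k \<in> {1..m * n}"
    have [measurable]: "(\<lambda>\<omega>. pa_R m n (fst \<omega>) k) \<in> borel_measurable ?M"
      using k by (intro measurable_compose[OF measurable_fst pa_R_measurable]) auto
    have [measurable]: "(\<lambda>\<omega>. snd \<omega> k) \<in> borel_measurable ?M"
      using k by (intro measurable_compose[OF measurable_snd measurable_component_singleton]) auto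
    show "(\<lambda>\<omega>. of_bool (pa_vertex m n (fst \<omega>) (pa_R m n (fst \<omega>) k) = j) +
                of_bool (pa_vertex m n (fst \<omega>) (snd \<omega> k) = j) :: nat) \<in> measurable ?M (count_space UNIV)"
      by measurable
  qed
  thus ?thesis
    by (simp cong: measurable_cong_sets)
qed

end

theory Submission
  imports Defs "HOL-Real_Asymp.Real_Asymp"
begin

text \<open>
  The normalisation by \<open>W (m n + 1)\<close> cancels in the conditional probability that \<open>l k\<close> lands in
  the interval of \<open>j\<close>, which is at most \<open>\<Delta> j / (2 sqrt (W k * W (m (j - 1))))\<close> with
  \<open>\<Delta> j = W (m j) - W (m (j - 1))\<close>. With high probability \<open>W k \<ge> (1 - \<epsilon>) k\<close> for all relevant \<open>k\<close>
  and \<open>\<Delta> j \<le> (1 + \<epsilon>) ln n\<close> for all \<open>j\<close>; then the conditional mean of the in-degree of \<open>j\<close> is at most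
  \<open>\<mu> = (1 + O(\<epsilon>)) (sqrt (n / j) - 1) ln n\<close>. A Chernoff bound makes the probability of exceeding
  \<open>z \<mu>\<close> roughly \<open>exp (- \<mu> I(z))\<close>, where \<open>I(z) = z ln z + 1 - z = 1 / \<phi>(z)\<close> is the large deviation
  rate of the Poisson distribution, and \<open>z > z(\<sigma>)\<close> is exactly what pushes this below \<open>1 / n\<close> by a
  power of \<open>n\<close> for every \<open>j \<le> (1 - \<sigma>) n\<close>, so that a union bound over \<open>j\<close> applies.
\<close>

section \<open>The root\<close>

definition poisson_rate :: "real \<Rightarrow> real" where
  "poisson_rate z = z * ln z + 1 - z"

definition pa_level :: "real \<Rightarrow> real" where
  "pa_level \<sigma> = (1 - \<sigma>) powr (-1/2) - 1"

lemma poisson_rate_1 [simp]: "poisson_rate 1 = 0"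
  by (simp add: poisson_rate_def)

lemma strict_mono_on_poisson_rate: "strict_mono_on {1..} poisson_rate"
proof (rule strict_mono_onI)
  fix x y :: real
  assume xy: "x \<in> {1..}" "x < y"
  show "poisson_rate x < poisson_rate y"
  proof (rule DERIV_pos_imp_increasing_open[OF \<open>x < y\<close>])
    fix u assume "x < u" "u < y"
    then have "0 < ln u" "(poisson_rate has_real_derivative ln u) (at u)"
      using xy unfolding poisson_rate_def [abs_def] by (auto intro!: derivative_eq_intros)
    then show "\<exists>d. (poisson_rate has_real_derivative d) (at u) \<and> 0 < d" by blast
  qed (use xy in \<open>auto simp: poisson_rate_def [abs_def] intro!: continuous_intros\<close>)
qed

lemmas poisson_rate_less_iff = strict_mono_on_less[OF strict_mono_on_poisson_rate]
lemmas poisson_rate_eq_iff = strict_mono_on_eq[OF strict_mono_on_poisson_rate]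

lemma ex_poisson_rate_eq:
  assumes "0 < y"
  obtains z where "1 < z" "poisson_rate z = y"
proof -
  have "filterlim poisson_rate at_top at_top"
    unfolding poisson_rate_def [abs_def] by real_asymp
  then obtain b where "\<And>z. b \<le> z \<Longrightarrow> y \<le> poisson_rate z"
    by (auto simp: filterlim_at_top eventually_at_top_linorder)
  then have "y \<le> poisson_rate (max b 1)" by simp
  then have "\<exists>z\<ge>1. z \<le> max b 1 \<and> poisson_rate z = y"
    using assms
    by (intro IVT') (auto simp: poisson_rate_def [abs_def] intro!: continuous_intros)
  then obtain z where z: "1 \<le> z" "poisson_rate z = y" by blast
  with assms have "z \<noteq> 1" by auto
  with z show ?thesis by (intro that) auto
qed

lemma pa_level_pos: "\<sigma> \<in> {0<..<1} \<Longrightarrow> 0 < pa_level \<sigma>"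
  using powr_less_mono2_neg[of "-1/2" "1 - \<sigma>" 1] by (simp add: pa_level_def)

lemma pa_is_root_iff:
  assumes "\<sigma> \<in> {0<..<1}"
  shows "pa_is_root \<sigma> z \<longleftrightarrow> 1 < z \<and> poisson_rate z = inverse (pa_level \<sigma>)"
  using pa_level_pos[OF assms]
  by (auto simp: pa_is_root_def pa_phi_def poisson_rate_def pa_level_def inverse_eq_imp_eq)

lemma pa_root_ex1:
  assumes "\<sigma> \<in> {0<..<1}"
  shows "\<exists>!z. pa_is_root \<sigma> z"
proof -
  obtain z where z: "1 < z" "poisson_rate z = inverse (pa_level \<sigma>)"
    using ex_poisson_rate_eq[of "inverse (pa_level \<sigma>)"] pa_level_pos[OF assms] by auto
  show ?thesis
  proof (rule ex1I)
    show "pa_is_root \<sigma> z" using z by (simp add: pa_is_root_iff[OF assms])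
    show "u = z" if "pa_is_root \<sigma> u" for u
      using that z poisson_rate_eq_iff[of u z] by (simp add: pa_is_root_iff[OF assms])
  qed
qed

lemma
  assumes "\<sigma> \<in> {0<..<1}"
  shows pa_root_gt_1: "1 < pa_root \<sigma>"
    and poisson_rate_pa_root: "poisson_rate (pa_root \<sigma>) = inverse (pa_level \<sigma>)"
  using theI'[OF pa_root_ex1[OF assms]] by (simp_all add: pa_root_def pa_is_root_iff[OF assms])

lemma eventually_at_right_unit_interval: "\<forall>\<^sub>F \<sigma> in at_right 0. \<sigma> \<in> {0<..<1::real}"
  by (rule eventually_at_right_real) simp

lemma pa_root_at_top: "filterlim pa_root at_top (at_right 0)"
  unfolding filterlim_at_top_ge[where c = 1]
proof (intro allI impI)
  fix Z :: real
  assume Z: "1 \<le> Z"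
  have "filterlim (\<lambda>\<sigma>. inverse (pa_level \<sigma>)) at_top (at_right 0)"
    unfolding pa_level_def by real_asymp
  then have "\<forall>\<^sub>F \<sigma> in at_right 0. poisson_rate Z < inverse (pa_level \<sigma>)"
    by (simp add: filterlim_at_top_dense)
  then show "\<forall>\<^sub>F \<sigma> in at_right 0. Z \<le> pa_root \<sigma>"
    using eventually_at_right_unit_interval
  proof eventually_elim
    case (elim \<sigma>)
    then have "poisson_rate Z < poisson_rate (pa_root \<sigma>)" by (simp only: poisson_rate_pa_root)
    then show ?case using Z pa_root_gt_1[OF elim(2)] by (simp add: poisson_rate_less_iff)
  qed
qed

lemma pa_root_asymp_equiv: "pa_root \<sim>[at_right 0] (\<lambda>\<sigma>. 2 * inverse (\<sigma> * ln (1 / \<sigma>)))"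
proof -
  have "(\<lambda>z. z) \<sim>[at_top] (\<lambda>z. poisson_rate z / ln (poisson_rate z))"
    unfolding poisson_rate_def by real_asymp
  from asymp_equiv_compose'[OF this pa_root_at_top]
  have "pa_root \<sim>[at_right 0] (\<lambda>\<sigma>. poisson_rate (pa_root \<sigma>) / ln (poisson_rate (pa_root \<sigma>)))" .
  also have "\<dots> \<sim>[at_right 0] (\<lambda>\<sigma>. inverse (pa_level \<sigma>) / ln (inverse (pa_level \<sigma>)))"
    by (intro asymp_equiv_refl_ev eventually_mono[OF eventually_at_right_unit_interval])
       (simp only: poisson_rate_pa_root)
  also have "\<dots> \<sim>[at_right 0] (\<lambda>\<sigma>. 2 * inverse (\<sigma> * ln (1 / \<sigma>)))"
    unfolding pa_level_def by real_asymp
  finally show ?thesis .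
qed

section \<open>Chernoff bounds for independent random variables\<close>

lemma indep_vars_PiM_components:
  assumes "\<And>i. i \<in> I \<Longrightarrow> prob_space (M i)"
  shows "prob_space.indep_vars (Pi\<^sub>M I M) M (\<lambda>i x. x i) I"
proof -
  interpret prob_space "Pi\<^sub>M I M" by (rule prob_space_PiM) fact
  show ?thesis
  proof (cases "I = {}")
    case False
    have "distr (Pi\<^sub>M I M) (Pi\<^sub>M I M) (\<lambda>x. \<lambda>i\<in>I. x i) = distr (Pi\<^sub>M I M) (Pi\<^sub>M I M) (\<lambda>x. x)"
      by (intro distr_cong refl) (auto simp: space_PiM)
    also have "\<dots> = Pi\<^sub>M I (\<lambda>i. distr (Pi\<^sub>M I M) (M i) (\<lambda>x. x i))"
      unfolding distr_id2[OF refl] by (intro PiM_cong refl distr_PiM_component[symmetric] assms)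
    finally show ?thesis
      using False by (intro indep_vars_iff_distr_eq_PiM'[THEN iffD2]) auto
  next
    case True
    then show ?thesis unfolding indep_vars_def2 indep_sets_def by blast
  qed
qed

lemma (in prob_space) Chernoff_sum_indep_vars_ge:
  fixes X :: "'i \<Rightarrow> 'a \<Rightarrow> real" and a s :: real
  assumes "finite I" "indep_vars (\<lambda>_. borel) X I" "0 < s"
  shows "emeasure M {x \<in> space M. a \<le> (\<Sum>i\<in>I. X i x)}
           \<le> ennreal (exp (- s * a)) * (\<Prod>i\<in>I. \<integral>\<^sup>+x. exp (s * X i x) \<partial>M)"
proof -
  have [measurable]: "random_variable borel (X i)" if "i \<in> I" for i
    using assms(2) that by (simp add: indep_vars_def)
  have "emeasure M {x \<in> space M. a \<le> (\<Sum>i\<in>I. X i x)}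
      \<le> ennreal (exp (- s * a)) * (\<integral>\<^sup>+x\<in>space M. exp (s * (\<Sum>i\<in>I. X i x)) \<partial>M)"
    by (intro Chernoff_ineq_nn_integral_ge assms) auto
  also have "(\<integral>\<^sup>+x\<in>space M. exp (s * (\<Sum>i\<in>I. X i x)) \<partial>M)
      = (\<integral>\<^sup>+x. (\<Prod>i\<in>I. ennreal (exp (s * X i x))) \<partial>M)"
    using \<open>finite I\<close>
    by (intro nn_integral_cong) (simp add: sum_distrib_left exp_sum prod_ennreal)
  also have "\<dots> = (\<Prod>i\<in>I. \<integral>\<^sup>+x. exp (s * X i x) \<partial>M)"
    by (intro indep_vars_nn_integral indep_vars_compose2[OF assms(2)] assms(1)) auto
  finally show ?thesis .
qed

lemma (in prob_space) nn_integral_exp_indicator_le: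
  fixes s q :: real
  assumes E [measurable]: "E \<in> events" and s: "0 \<le> s" and q: "prob E \<le> q"
  shows "(\<integral>\<^sup>+x. exp (s * indicator E x) \<partial>M) \<le> ennreal (exp ((exp s - 1) * q))"
proof -
  have "ennreal (exp s) = 1 + ennreal (exp s - 1)"
    using s ennreal_plus[of 1 "exp s - 1"] by simp
  then have "(\<integral>\<^sup>+x. exp (s * indicator E x) \<partial>M)
      = (\<integral>\<^sup>+x. 1 + ennreal (exp s - 1) * indicator E x \<partial>M)"
    by (intro nn_integral_cong) (simp add: indicator_def)
  also have "\<dots> = 1 + ennreal (exp s - 1) * ennreal (prob E)"
    by (simp add: nn_integral_add nn_integral_cmult emeasure_eq_measure prob_space)
  also have "\<dots> = ennreal (1 + (exp s - 1) * prob E)"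
    using s by (simp flip: ennreal_mult ennreal_1 ennreal_plus)
  also have "\<dots> \<le> ennreal (exp ((exp s - 1) * q))"
  proof (rule ennreal_leI)
    have "1 + (exp s - 1) * prob E \<le> 1 + (exp s - 1) * q"
      using s q by (intro add_left_mono mult_left_mono) auto
    also have "\<dots> \<le> exp ((exp s - 1) * q)" by (rule exp_ge_add_one_self)
    finally show "1 + (exp s - 1) * prob E \<le> exp ((exp s - 1) * q)" .
  qed
  finally show ?thesis .
qed

lemma (in prob_space) Chernoff_card_indep_vars_ge:
  fixes z t :: real and q :: "'i \<Rightarrow> real"
  assumes "finite I" and indep: "indep_vars N X I" and "1 < z"
    and A: "\<And>i. i \<in> I \<Longrightarrow> A i \<in> sets (N i)"
    and q: "\<And>i. i \<in> I \<Longrightarrow> prob {x \<in> space M. X i x \<in> A i} \<le> q i"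
  shows "emeasure M {x \<in> space M. t \<le> real (card {i \<in> I. X i x \<in> A i})}
           \<le> ennreal (exp ((z - 1) * (\<Sum>i\<in>I. q i) - t * ln z))"
proof -
  let ?Y = "\<lambda>i x. indicator (A i) (X i x) :: real"
  have Y: "indep_vars (\<lambda>_. borel) ?Y I"
    using A by (intro indep_vars_compose2[OF indep]) auto
  have mgf: "(\<integral>\<^sup>+x. exp (ln z * ?Y i x) \<partial>M) \<le> ennreal (exp ((z - 1) * q i))" if i: "i \<in> I" for i
  proof -
    have [measurable]: "random_variable (N i) (X i)" "A i \<in> sets (N i)"
      using indep A i by (simp_all add: indep_vars_def)
    have "(\<integral>\<^sup>+x. exp (ln z * ?Y i x) \<partial>M)
        = (\<integral>\<^sup>+x. exp (ln z * indicator {x \<in> space M. X i x \<in> A i} x) \<partial>M)"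
      by (intro nn_integral_cong) (simp add: indicator_def)
    also have "\<dots> \<le> ennreal (exp ((exp (ln z) - 1) * q i))"
      using \<open>1 < z\<close> q[OF i] by (intro nn_integral_exp_indicator_le) auto
    finally show ?thesis using \<open>1 < z\<close> by simp
  qed
  have card: "real (card {i \<in> I. X i x \<in> A i}) = (\<Sum>i\<in>I. ?Y i x)" for x
    using \<open>finite I\<close> by (simp add: indicator_def sum.If_cases Int_def)
  have "emeasure M {x \<in> space M. t \<le> real (card {i \<in> I. X i x \<in> A i})}
      \<le> ennreal (exp (- ln z * t)) * (\<Prod>i\<in>I. \<integral>\<^sup>+x. exp (ln z * ?Y i x) \<partial>M)"
    unfolding card using \<open>finite I\<close> Y \<open>1 < z\<close> by (intro Chernoff_sum_indep_vars_ge) simp_all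
  also have "\<dots> \<le> ennreal (exp (- ln z * t)) * (\<Prod>i\<in>I. ennreal (exp ((z - 1) * q i)))"
    by (intro mult_left_mono prod_mono_ennreal mgf) auto
  also have "\<dots> = ennreal (exp ((z - 1) * (\<Sum>i\<in>I. q i) - t * ln z))"
    using \<open>finite I\<close>
    by (simp add: prod_ennreal sum_distrib_left algebra_simps exp_sum[symmetric]
        flip: ennreal_mult exp_add)
  finally show ?thesis .
qed

lemma (in prob_space) nn_integral_exp_exponential_distributed:
  fixes X :: "'a \<Rightarrow> real"
  assumes D: "distributed M lborel X (exponential_density l)" and t: "0 < l" "t < l"
  shows "(\<integral>\<^sup>+x. exp (t * X x) \<partial>M) = ennreal (l / (l - t))"
proof -
  interpret E: prob_space "density lborel (exponential_density (l - t))"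
    using t by (intro prob_space_exponential_density) simp
  have "(\<integral>\<^sup>+x. exp (t * X x) \<partial>M)
      = (\<integral>\<^sup>+u. ennreal (exponential_density l u) * ennreal (exp (t * u)) \<partial>lborel)"
    by (subst distributed_nn_integral[OF D, symmetric]) auto
  also have "\<dots> = (\<integral>\<^sup>+u. ennreal (l / (l - t)) * ennreal (exponential_density (l - t) u) \<partial>lborel)"
  proof (rule nn_integral_cong)
    fix u :: real
    have "exp (- u * l) * exp (t * u) = exp (- u * (l - t))"
      by (simp add: algebra_simps flip: exp_add)
    then have "exponential_density l u * exp (t * u) = l / (l - t) * exponential_density (l - t) u"
      using t by (simp add: exponential_density_def)
    then show "ennreal (exponential_density l u) * ennreal (exp (t * u))
        = ennreal (l / (l - t)) * ennreal (exponential_density (l - t) u)"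
      using t by (simp add: exponential_density_nonneg flip: ennreal_mult)
  qed
  also have "\<dots> = ennreal (l / (l - t)) * (\<integral>\<^sup>+u. ennreal (exponential_density (l - t) u) \<partial>lborel)"
    by (rule nn_integral_cmult) simp
  also have "(\<integral>\<^sup>+u. ennreal (exponential_density (l - t) u) \<partial>lborel) = 1"
    using E.emeasure_space_1 by (simp add: emeasure_density)
  finally show ?thesis by simp
qed

lemma (in prob_space) exponential_distributed_sum_Chernoff_ge:
  fixes X :: "'i \<Rightarrow> 'a \<Rightarrow> real"
  assumes "finite I" "indep_vars (\<lambda>_. borel) X I"
    and D: "\<And>i. i \<in> I \<Longrightarrow> distributed M lborel (X i) (exponential_density l)"
    and t: "0 < t" "t < l"
  shows "emeasure M {x \<in> space M. a \<le> (\<Sum>i\<in>I. X i x)}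
           \<le> ennreal (exp (- t * a) * (l / (l - t)) ^ card I)"
proof -
  have "(\<Prod>i\<in>I. \<integral>\<^sup>+x. exp (t * X i x) \<partial>M) = (\<Prod>i\<in>I. ennreal (l / (l - t)))"
    using t by (intro prod.cong refl nn_integral_exp_exponential_distributed D) auto
  then show ?thesis
    using Chernoff_sum_indep_vars_ge[OF assms(1,2) t(1), of a] t
    by (simp add: ennreal_power ennreal_mult)
qed

lemma (in prob_space) exponential_distributed_sum_Chernoff_le:
  fixes X :: "'i \<Rightarrow> 'a \<Rightarrow> real"
  assumes "finite I" and indep: "indep_vars (\<lambda>_. borel) X I"
    and D: "\<And>i. i \<in> I \<Longrightarrow> distributed M lborel (X i) (exponential_density l)"
    and l: "0 < l" and \<epsilon>: "0 < \<epsilon>" "\<epsilon> < 1"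
  shows "emeasure M {x \<in> space M. (\<Sum>i\<in>I. X i x) \<le> (1 - \<epsilon>) * (real (card I) / l)}
           \<le> ennreal (((1 - \<epsilon>) * exp \<epsilon>) ^ card I)"
proof -
  \<comment> \<open>the minimiser of the Chernoff bound\<close>
  define s where "s = l * \<epsilon> / (1 - \<epsilon>)"
  have s: "0 < s" using l \<epsilon> by (simp add: s_def)
  have "l / (l + s) = 1 - \<epsilon>" using l \<epsilon> by (simp add: s_def field_simps)
  then have "(\<Prod>i\<in>I. \<integral>\<^sup>+x. exp (s * - X i x) \<partial>M) = (\<Prod>i\<in>I. ennreal (1 - \<epsilon>))"
    using nn_integral_exp_exponential_distributed[OF D, of _ "- s"] l s by simp
  moreover have "indep_vars (\<lambda>_. borel) (\<lambda>i x. - X i x) I"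
    by (intro indep_vars_compose2[OF indep]) auto
  moreover have "s * ((1 - \<epsilon>) * (real (card I) / l)) = real (card I) * \<epsilon>"
    using l \<epsilon> by (simp add: s_def field_simps)
  then have "exp (s * ((1 - \<epsilon>) * (real (card I) / l))) = exp \<epsilon> ^ card I"
    by (simp only: exp_of_nat_mult)
  ultimately have "emeasure M {x \<in> space M. (\<Sum>i\<in>I. X i x) \<le> (1 - \<epsilon>) * (real (card I) / l)}
      \<le> ennreal (exp \<epsilon> ^ card I) * (\<Prod>i\<in>I. ennreal (1 - \<epsilon>))"
    using Chernoff_sum_indep_vars_ge[OF \<open>finite I\<close> _ s, of "\<lambda>i x. - X i x"
        "- ((1 - \<epsilon>) * (real (card I) / l))"]
    by (simp only: sum_negf neg_le_iff_le minus_mult_minus)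
  also have "\<dots> = ennreal (((1 - \<epsilon>) * exp \<epsilon>) ^ card I)"
    using \<epsilon> by (simp add: ennreal_power power_mult_distrib mult.commute flip: ennreal_mult)
  finally show ?thesis .
qed

section \<open>Union bound and disintegration\<close>

lemma emeasure_Bex_le_sum:
  assumes "finite K"
    and "\<And>k. k \<in> K \<Longrightarrow> {x \<in> space M. P k x} \<in> sets M"
    and le: "\<And>k. k \<in> K \<Longrightarrow> emeasure M {x \<in> space M. P k x} \<le> ennreal (b k)"
    and "\<And>k. k \<in> K \<Longrightarrow> 0 \<le> b k"
  shows "emeasure M {x \<in> space M. \<exists>k\<in>K. P k x} \<le> ennreal (\<Sum>k\<in>K. b k)"
proof -
  have "{x \<in> space M. \<exists>k\<in>K. P k x} = (\<Union>k\<in>K. {x \<in> space M. P k x})" by blast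
  also have "emeasure M \<dots> \<le> (\<Sum>k\<in>K. emeasure M {x \<in> space M. P k x})"
    using assms by (intro emeasure_subadditive_finite) auto
  also have "\<dots> \<le> (\<Sum>k\<in>K. ennreal (b k))" by (rule sum_mono[OF le])
  also have "\<dots> = ennreal (\<Sum>k\<in>K. b k)" using assms by simp
  finally show ?thesis .
qed

lemma (in prob_space) nn_integral_le_emeasure_plus:
  assumes A: "A \<in> events"
    and le_1: "AE x in M. f x \<le> 1" and le_c: "AE x in M. x \<notin> A \<longrightarrow> f x \<le> c"
  shows "(\<integral>\<^sup>+x. f x \<partial>M) \<le> emeasure M A + c"
proof -
  have "(\<integral>\<^sup>+x. f x \<partial>M) \<le> (\<integral>\<^sup>+x. indicator A x + c \<partial>M)"
  proof (rule nn_integral_mono_AE)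
    show "AE x in M. f x \<le> indicator A x + c"
      using le_1 le_c
    proof eventually_elim
      case (elim x)
      then show ?case by (cases "x \<in> A") (auto intro: add_increasing2)
    qed
  qed
  also have "\<dots> = emeasure M A + c"
    using A by (simp add: nn_integral_add emeasure_space_1)
  finally show ?thesis .
qed

lemma emeasure_bind_return_pair:
  assumes K: "K \<in> measurable M (subprob_algebra N)" and M: "space M \<noteq> {}"
    and B [measurable]: "B \<in> sets (M \<Otimes>\<^sub>M N)"
  shows "emeasure (M \<bind> (\<lambda>x. K x \<bind> (\<lambda>y. return (M \<Otimes>\<^sub>M N) (x, y)))) B
           = (\<integral>\<^sup>+x. emeasure (K x) (Pair x -` B) \<partial>M)"
proof -
  note [measurable] = K
  have "emeasure (M \<bind> (\<lambda>x. K x \<bind> (\<lambda>y. return (M \<Otimes>\<^sub>M N) (x, y)))) B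
      = (\<integral>\<^sup>+x. emeasure (K x \<bind> (\<lambda>y. return (M \<Otimes>\<^sub>M N) (x, y))) B \<partial>M)"
    by (rule emeasure_bind[OF M _ B]) measurable
  also have "\<dots> = (\<integral>\<^sup>+x. emeasure (K x) (Pair x -` B) \<partial>M)"
  proof (rule nn_integral_cong)
    fix x assume x: "x \<in> space M"
    interpret subprob_space "K x" by (rule subprob_space_kernel[OF K x])
    note sets_K [measurable_cong] = sets_kernel[OF K x]
    have "emeasure (K x \<bind> (\<lambda>y. return (M \<Otimes>\<^sub>M N) (x, y))) B
        = (\<integral>\<^sup>+y. emeasure (return (M \<Otimes>\<^sub>M N) (x, y)) B \<partial>K x)"
      using x by (intro emeasure_bind[OF subprob_not_empty _ B]) measurable
    also have "\<dots> = (\<integral>\<^sup>+y. indicator (Pair x -` B) y \<partial>K x)"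
      by (intro nn_integral_cong) (simp add: indicator_def)
    also have "\<dots> = emeasure (K x) (Pair x -` B)"
      using sets_Pair1[OF B, of x] by (simp add: sets_K)
    finally show "emeasure (K x \<bind> (\<lambda>y. return (M \<Otimes>\<^sub>M N) (x, y))) B
        = emeasure (K x) (Pair x -` B)" .
  qed
  finally show ?thesis .
qed


section \<open>Concentration of the gaps\<close>

interpretation pa_w_law: prob_space "pa_w_law m n" for m n
  by (rule prob_space_pa_w_law)

interpretation pa_space: prob_space "pa_space m n" for m n
  by (rule prob_space_pa_space)

lemma prob_space_exponential_density_1: "prob_space (density lborel (exponential_density 1))"
  by (rule prob_space_exponential_density) simp

lemma pa_w_law_indep_vars: "pa_w_law.indep_vars m n (\<lambda>_. borel) (\<lambda>i w. w i) {1..m * n + 1}"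
proof (rule pa_w_law.indep_vars_compose2[where Y = "\<lambda>_ x. x"])
  show "pa_w_law.indep_vars m n
      (\<lambda>_. density lborel (exponential_density 1)) (\<lambda>i w. w i) {1..m * n + 1}"
    unfolding pa_w_law_def by (intro indep_vars_PiM_components prob_space_exponential_density_1)
qed simp

lemma pa_w_law_distributed:
  assumes "i \<in> {1..m * n + 1}"
  shows "distributed (pa_w_law m n) lborel (\<lambda>w. w i) (exponential_density 1)"
proof -
  let ?E = "density lborel (exponential_density 1)"
  have "distr (pa_w_law m n) lborel (\<lambda>w. w i) = distr (pa_w_law m n) ?E (\<lambda>w. w i)"
    by (intro distr_cong) auto
  also have "\<dots> = ?E"
    unfolding pa_w_law_def by (intro distr_PiM_component prob_space_exponential_density_1 assms)
  finally show ?thesis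
    using assms
    by (simp add: distributed_def measurable_component_singleton cong: measurable_cong_sets)
qed

definition pa_block :: "nat \<Rightarrow> nat \<Rightarrow> nat set" where
  "pa_block m j = {m * (j - 1) + 1..m * j}"

definition pa_width :: "nat \<Rightarrow> (nat \<Rightarrow> real) \<Rightarrow> nat \<Rightarrow> real" where
  "pa_width m w j = pa_W w (m * j) - pa_W w (m * (j - 1))"

lemma card_pa_block: "1 \<le> j \<Longrightarrow> card (pa_block m j) = m"
  by (cases j) (simp_all add: pa_block_def)

lemma finite_pa_block [simp]: "finite (pa_block m j)"
  by (simp add: pa_block_def)

lemma pa_block_subset:
  assumes "j \<le> n"
  shows "pa_block m j \<subseteq> {1..m * n}"
proof -
  have "m * j \<le> m * n" using assms by simp
  then show ?thesis by (auto simp: pa_block_def)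
qed

lemma pa_W_diff:
  assumes "i \<le> j"
  shows "pa_W w j - pa_W w i = (\<Sum>k=i+1..j. w k)"
  using sum.ub_add_nat[of 1 i w "j - i"] assms by (simp add: pa_W_def)

lemma pa_width_eq_sum: "pa_width m w j = (\<Sum>k\<in>pa_block m j. w k)"
  unfolding pa_width_def pa_block_def by (rule pa_W_diff) simp

lemma pa_w_law_measurable_sum:
  assumes "S \<subseteq> {1..m * n + 1}"
  shows "(\<lambda>w. \<Sum>i\<in>S. w i) \<in> borel_measurable (pa_w_law m n)"
  using assms pa_w_law_distributed[THEN distributed_measurable]
  by (intro borel_measurable_sum) auto

definition pa_small_W :: "nat \<Rightarrow> nat \<Rightarrow> real \<Rightarrow> nat \<Rightarrow> (nat \<Rightarrow> real) set" where
  "pa_small_W m n \<epsilon> k\<^sub>0 =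
     {w \<in> space (pa_w_law m n). \<exists>k\<in>{k\<^sub>0..m * n}. pa_W w k \<le> (1 - \<epsilon>) * real k}"

definition pa_wide :: "nat \<Rightarrow> nat \<Rightarrow> real \<Rightarrow> (nat \<Rightarrow> real) set" where
  "pa_wide m n x = {w \<in> space (pa_w_law m n). \<exists>j\<in>{1..n}. x \<le> pa_width m w j}"

lemma sets_pa_W_le:
  "k \<le> m * n + 1 \<Longrightarrow> {w \<in> space (pa_w_law m n). pa_W w k \<le> x} \<in> sets (pa_w_law m n)"
  unfolding pa_W_def by (intro borel_measurable_le pa_w_law_measurable_sum) auto

lemma sets_pa_width_ge:
  assumes "j \<in> {1..n}"
  shows "{w \<in> space (pa_w_law m n). x \<le> pa_width m w j} \<in> sets (pa_w_law m n)"
  unfolding pa_width_eq_sum using assms pa_block_subset[of j n m]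
  by (intro borel_measurable_le pa_w_law_measurable_sum) auto

lemma sets_pa_small_W: "pa_small_W m n \<epsilon> k\<^sub>0 \<in> sets (pa_w_law m n)"
  unfolding pa_small_W_def by (intro sets.sets_Collect_finite_Ex sets_pa_W_le) auto

lemma sets_pa_wide: "pa_wide m n x \<in> sets (pa_w_law m n)"
  unfolding pa_wide_def by (intro sets.sets_Collect_finite_Ex sets_pa_width_ge) auto

lemma one_minus_mult_exp_less_1:
  fixes x :: real
  assumes "x \<noteq> 0"
  shows "(1 - x) * exp x < 1"
  using exp_minus_greater[of x] assms by (simp add: exp_minus field_simps)

lemma emeasure_pa_small_W_le:
  assumes \<epsilon>: "\<epsilon> \<in> {0<..<1}"
  defines "q \<equiv> (1 - \<epsilon>) * exp \<epsilon>"
  shows "emeasure (pa_w_law m n) (pa_small_W m n \<epsilon> k\<^sub>0) \<le> ennreal (q ^ k\<^sub>0 / (1 - q))"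
proof -
  have q: "0 \<le> q" "q < 1"
    using \<epsilon> one_minus_mult_exp_less_1[of \<epsilon>] by (auto simp: q_def)
  have "emeasure (pa_w_law m n) (pa_small_W m n \<epsilon> k\<^sub>0) \<le> ennreal (\<Sum>k=k\<^sub>0..m * n. q ^ k)"
    unfolding pa_small_W_def
  proof (rule emeasure_Bex_le_sum)
    fix k assume "k \<in> {k\<^sub>0..m * n}"
    then have sub: "{1..k} \<subseteq> {1..m * n + 1}" by auto
    have "emeasure (pa_w_law m n) {w \<in> space (pa_w_law m n). (\<Sum>i\<in>{1..k}. w i)
        \<le> (1 - \<epsilon>) * (real (card {1..k}) / 1)} \<le> ennreal (q ^ card {1..k})"
      unfolding q_def using \<epsilon> sub
      by (intro pa_w_law.exponential_distributed_sum_Chernoff_le pa_w_law_distributed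
          pa_w_law.indep_vars_subset[OF pa_w_law_indep_vars]) auto
    then show "emeasure (pa_w_law m n) {w \<in> space (pa_w_law m n). pa_W w k \<le> (1 - \<epsilon>) * real k}
        \<le> ennreal (q ^ k)"
      by (simp add: pa_W_def)
  next
    show "{w \<in> space (pa_w_law m n). pa_W w k \<le> (1 - \<epsilon>) * real k} \<in> sets (pa_w_law m n)"
      if "k \<in> {k\<^sub>0..m * n}" for k
      using that by (intro sets_pa_W_le) simp
  qed (use q in simp_all)
  also have "(\<Sum>k=k\<^sub>0..m * n. q ^ k) \<le> q ^ k\<^sub>0 / (1 - q)"
    using q by (auto simp: sum_gp intro!: divide_right_mono)
  finally show ?thesis by (simp add: ennreal_leI)
qed

lemma emeasure_pa_wide_le:
  assumes t: "t \<in> {0<..<1}"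
  shows "emeasure (pa_w_law m n) (pa_wide m n x)
           \<le> ennreal (real n * (exp (- t * x) * (1 / (1 - t)) ^ m))"
proof -
  have "emeasure (pa_w_law m n) (pa_wide m n x)
      \<le> ennreal (\<Sum>j\<in>{1..n}. exp (- t * x) * (1 / (1 - t)) ^ m)"
    unfolding pa_wide_def
  proof (rule emeasure_Bex_le_sum)
    fix j assume j: "j \<in> {1..n}"
    then have sub: "pa_block m j \<subseteq> {1..m * n + 1}" using pa_block_subset[of j n m] by auto
    have "emeasure (pa_w_law m n) {w \<in> space (pa_w_law m n). x \<le> (\<Sum>i\<in>pa_block m j. w i)}
        \<le> ennreal (exp (- t * x) * (1 / (1 - t)) ^ card (pa_block m j))"
      using t sub
      by (intro pa_w_law.exponential_distributed_sum_Chernoff_ge pa_w_law_distributed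
          pa_w_law.indep_vars_subset[OF pa_w_law_indep_vars]) auto
    then show "emeasure (pa_w_law m n) {w \<in> space (pa_w_law m n). x \<le> pa_width m w j}
        \<le> ennreal (exp (- t * x) * (1 / (1 - t)) ^ m)"
      using j by (simp add: pa_width_eq_sum card_pa_block)
  next
    show "0 \<le> exp (- t * x) * (1 / (1 - t)) ^ m" using t by simp
  qed (simp_all only: finite_atLeastAtMost sets_pa_width_ge)
  then show ?thesis by simp
qed

lemma emeasure_pa_wide_log_le:
  assumes \<epsilon>: "0 < \<epsilon>" and n: "1 \<le> n"
  shows "emeasure (pa_w_law m n) (pa_wide m n ((1 + \<epsilon>) * ln (real n)))
           \<le> ennreal ((2 * (1 + \<epsilon>) / \<epsilon>) ^ m * real n powr (- \<epsilon> / 2))"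
proof -
  \<comment> \<open>any value strictly between \<open>1 / (1 + \<epsilon>)\<close> and \<open>1\<close> beats the union bound over \<open>n\<close> vertices\<close>
  define t where "t = (1 + \<epsilon> / 2) / (1 + \<epsilon>)"
  have t: "t \<in> {0<..<1}" "t * (1 + \<epsilon>) = 1 + \<epsilon> / 2" "1 / (1 - t) = 2 * (1 + \<epsilon>) / \<epsilon>"
    using \<epsilon> by (auto simp: t_def field_simps)
  have "exp (- t * ((1 + \<epsilon>) * ln (real n))) = exp (- (t * (1 + \<epsilon>)) * ln (real n))"
    by (simp add: mult.assoc)
  also have "\<dots> = real n powr (- 1 - \<epsilon> / 2)"
    using n unfolding t(2) by (simp add: powr_def)
  finally have "real n * exp (- t * ((1 + \<epsilon>) * ln (real n))) = real n powr (- \<epsilon> / 2)"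
    using powr_mult_base[of "real n" "- 1 - \<epsilon> / 2"] by simp
  then show ?thesis
    using emeasure_pa_wide_le[OF t(1), of m n "(1 + \<epsilon>) * ln (real n)"]
    unfolding t(3) mult.assoc[symmetric] by (simp add: mult_ac)
qed

section \<open>Degrees conditionally on the gaps\<close>

definition pa_late_ends :: "nat \<Rightarrow> nat \<Rightarrow> (nat \<Rightarrow> real) \<Rightarrow> (nat \<Rightarrow> real) \<Rightarrow> nat \<Rightarrow> nat set" where
  "pa_late_ends m n w l j = {k \<in> {m * j + 1..m * n}. l k \<in> pa_interval m n w j}"

definition pa_late_mean_bound :: "nat \<Rightarrow> nat \<Rightarrow> (nat \<Rightarrow> real) \<Rightarrow> nat \<Rightarrow> real" where
  "pa_late_mean_bound m n w j =
     (\<Sum>k=m * j + 1..m * n. pa_width m w j / (2 * sqrt (pa_W w k * pa_W w (m * (j - 1)))))"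

lemma measure_pa_end_density_Ioc:
  assumes "0 < x" "x \<le> y" "0 < r"
  shows "measure (density lborel (pa_end_density r)) {x<..y} \<le> (y - x) / (2 * sqrt (r * x))"
proof -
  have "emeasure (density lborel (pa_end_density r)) {x<..y}
      = (\<integral>\<^sup>+u. ennreal (pa_end_density r u) * indicator {x<..y} u \<partial>lborel)"
    by (simp add: emeasure_density)
  also have "\<dots> \<le> (\<integral>\<^sup>+u. ennreal (1 / (2 * sqrt (r * x))) * indicator {x<..y} u \<partial>lborel)"
    using assms
    by (intro nn_integral_mono)
       (auto simp: pa_end_density_def indicator_def intro!: divide_left_mono ennreal_leI)
  also have "\<dots> = ennreal ((y - x) / (2 * sqrt (r * x)))"
    using assms by (simp add: nn_integral_cmult flip: ennreal_mult'')
  finally show ?thesis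
    unfolding measure_def using assms by (intro enn2real_leI) auto
qed

locale pa_positive_gaps =
  fixes m n :: nat and w :: "nat \<Rightarrow> real"
  assumes gap_pos: "i \<in> {1..m * n + 1} \<Longrightarrow> 0 < w i"
begin

abbreviation W :: "nat \<Rightarrow> real" where
  "W \<equiv> pa_W w"

abbreviation R :: "nat \<Rightarrow> real" where
  "R \<equiv> pa_R m n w"

lemma strict_mono_on_W: "strict_mono_on {..m * n + 1} W"
proof (rule strict_mono_onI)
  fix i j
  assume ij: "j \<in> {..m * n + 1}" "i < j"
  then have "0 < (\<Sum>k=i+1..j. w k)"
    by (intro sum_pos gap_pos) auto
  then show "W i < W j"
    using pa_W_diff[of i j w] ij by simp
qed

lemma W_pos: "0 < k \<Longrightarrow> k \<le> m * n + 1 \<Longrightarrow> 0 < W k"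
  using strict_mono_onD[OF strict_mono_on_W, of 0 k] by (simp add: pa_W_def)

lemma strict_mono_on_R: "strict_mono_on {..m * n} R"
  unfolding pa_R_def
  by (intro strict_mono_onI divide_strict_right_mono strict_mono_onD[OF strict_mono_on_W] W_pos)
     auto

lemmas R_less_iff = strict_mono_on_less[OF strict_mono_on_R, unfolded atMost_iff]
lemmas R_le_iff = strict_mono_on_less_eq[OF strict_mono_on_R, unfolded atMost_iff]

lemma R_0 [simp]: "R 0 = 0"
  by (simp add: pa_R_def pa_W_def)

lemma R_pos: "0 < k \<Longrightarrow> k \<le> m * n \<Longrightarrow> 0 < R k"
  using R_less_iff[of 0 k] by simp

lemma R_diff_div_sqrt_eq:
  assumes "1 \<le> k" "k \<le> m * n" "1 \<le> i" "i \<le> m * n"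
  shows "(R b - R a) / (2 * sqrt (R k * R i)) = (W b - W a) / (2 * sqrt (W k * W i))"
proof -
  have "0 < W k" "0 < W i" "0 < W (m * n + 1)" using assms by (auto intro!: W_pos)
  then show ?thesis
    by (simp add: pa_R_def real_sqrt_divide real_sqrt_mult flip: diff_divide_distrib)
qed

lemma ex1_pa_interval:
  assumes x: "0 < x" "x \<le> R (m * n)"
  shows "\<exists>!j. j \<in> {1..n} \<and> x \<in> pa_interval m n w j"
proof -
  define j where "j = (LEAST j. x \<le> R (m * j))"
  have j: "x \<le> R (m * j)" "j \<le> n"
    using x(2) unfolding j_def by (rule LeastI, rule Least_le)
  have "j \<noteq> 0" using j(1) x(1) by (intro notI) simp
  then have "\<not> x \<le> R (m * (j - 1))"
    unfolding j_def by (intro not_less_Least) simp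
  with j \<open>j \<noteq> 0\<close> have j_interval: "j \<in> {1..n} \<and> x \<in> pa_interval m n w j"
    by (auto simp: pa_interval_def)
  then show ?thesis
  proof (rule ex1I)
    fix i assume i: "i \<in> {1..n} \<and> x \<in> pa_interval m n w i"
    then have "R (m * (i - 1)) < R (m * j)" "R (m * (j - 1)) < R (m * i)"
      using j_interval by (simp_all add: pa_interval_def)
    then have "m * (i - 1) < m * j" "m * (j - 1) < m * i"
      using i j(2) by (simp_all add: R_less_iff le_diff_conv)
    then have "i - 1 < j" "j - 1 < i" by simp_all
    then show "i = j" by linarith
  qed
qed

lemma in_pa_interval_pa_vertex:
  assumes "0 < x" "x \<le> R (m * n)"
  shows "x \<in> pa_interval m n w (pa_vertex m n w x)"
  using theI'[OF ex1_pa_interval[OF assms]] by (simp add: pa_vertex_def)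

lemma R_in_pa_interval_iff:
  assumes "j \<le> n" "k \<le> m * n"
  shows "R k \<in> pa_interval m n w j \<longleftrightarrow> k \<in> pa_block m j"
  using assms by (simp add: pa_interval_def pa_block_def R_less_iff R_le_iff Suc_le_eq le_diff_conv)

lemma pa_vertex_R_block:
  assumes "j \<le> n" "k \<in> {1..m * n}" "pa_vertex m n w (R k) = j"
  shows "k \<in> pa_block m j"
  using assms in_pa_interval_pa_vertex[of "R k"] R_in_pa_interval_iff[of j k]
  by (simp add: R_pos R_le_iff)

lemma pa_vertex_end_block_or_late:
  assumes "j \<le> n" "k \<in> {1..m * n}" "pa_vertex m n w (l k) = j" and l: "l k \<in> {0<..R k}"
  shows "k \<in> pa_block m j \<union> pa_late_ends m n w l j"
proof -
  have "R k \<le> R (m * n)" using assms(2) by (simp add: R_le_iff)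
  then have l_interval: "l k \<in> pa_interval m n w j"
    using assms in_pa_interval_pa_vertex[of "l k"] by auto
  then have "R (m * (j - 1)) < R k" using l by (simp add: pa_interval_def)
  then have "m * (j - 1) < k"
    using assms by (simp add: R_less_iff le_diff_conv)
  with l_interval assms(2) show ?thesis
    by (cases "k \<le> m * j") (simp_all add: pa_block_def pa_late_ends_def)
qed

lemma mg_degree_pa_graph_le:
  assumes j: "j \<in> {1..n}" and l: "\<And>k. k \<in> {1..m * n} \<Longrightarrow> l k \<in> {0<..R k}"
  shows "mg_degree (pa_graph m n w l) j \<le> 2 * m + card (pa_late_ends m n w l j)"
proof -
  let ?V = "pa_vertex m n w"
  have fin: "finite (pa_block m j \<union> pa_late_ends m n w l j)"
    by (simp add: pa_late_ends_def)
  have "mg_degree (pa_graph m n w l) j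
      = card {k \<in> {1..m * n}. ?V (R k) = j} + card {k \<in> {1..m * n}. ?V (l k) = j}"
    by (simp add: mg_degree_pa_graph sum.distrib Int_def)
  also have "\<dots> \<le> card (pa_block m j) + card (pa_block m j \<union> pa_late_ends m n w l j)"
  proof (intro add_mono card_mono finite_pa_block fin subsetI)
    show "k \<in> pa_block m j" if "k \<in> {k \<in> {1..m * n}. ?V (R k) = j}" for k
      using that j by (intro pa_vertex_R_block) auto
    show "k \<in> pa_block m j \<union> pa_late_ends m n w l j" if "k \<in> {k \<in> {1..m * n}. ?V (l k) = j}" for k
      using that j l by (intro pa_vertex_end_block_or_late) auto
  qed
  also have "\<dots> \<le> 2 * m + card (pa_late_ends m n w l j)"
    using card_Un_le[of "pa_block m j" "pa_late_ends m n w l j"] j by (simp add: card_pa_block)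
  finally show ?thesis .
qed

lemma prob_space_end_law: "k \<in> {1..m * n} \<Longrightarrow> prob_space (density lborel (pa_end_density (R k)))"
  by (intro prob_space_pa_end_density R_pos) auto

sublocale l_law: prob_space "pa_l_law m n w"
  unfolding pa_l_law_def by (intro prob_space_PiM prob_space_end_law)

lemma indep_ends:
  "l_law.indep_vars (\<lambda>k. density lborel (pa_end_density (R k))) (\<lambda>k l. l k) {1..m * n}"
  unfolding pa_l_law_def by (intro indep_vars_PiM_components prob_space_end_law)

lemma prob_end_in:
  assumes k: "k \<in> {1..m * n}" and A: "A \<in> sets borel"
  shows "l_law.prob {l \<in> space (pa_l_law m n w). l k \<in> A}
           = measure (density lborel (pa_end_density (R k))) A"
proof -
  let ?D = "density lborel (pa_end_density (R k))"
  have "measure ?D A = measure (distr (pa_l_law m n w) ?D (\<lambda>l. l k)) A"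
    unfolding pa_l_law_def using k by (subst distr_PiM_component) (auto intro: prob_space_end_law)
  also have "\<dots> = l_law.prob {l \<in> space (pa_l_law m n w). l k \<in> A}"
    using k A unfolding pa_l_law_def
    by (subst measure_distr) (auto simp: vimage_def Int_def conj_commute)
  finally show ?thesis ..
qed

lemma AE_ends: "AE l in pa_l_law m n w. \<forall>k\<in>{1..m * n}. l k \<in> {0<..R k}"
  unfolding pa_l_law_def
proof (intro eventually_ball_finite ballI AE_PiM_component)
  show "AE x in density lborel (pa_end_density (R k)). x \<in> {0<..R k}" for k
    by (subst AE_density) (auto simp: pa_end_density_def)
qed (auto intro: prob_space_end_law)

lemma prob_late_end_le:
  assumes j: "2 \<le> j" and k: "k \<in> {m * j + 1..m * n}"
  shows "l_law.prob {l \<in> space (pa_l_law m n w). l k \<in> pa_interval m n w j}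
           \<le> pa_width m w j / (2 * sqrt (W k * W (m * (j - 1))))"
proof -
  let ?i = "m * (j - 1)"
  have "m \<noteq> 0" using k by (cases m) auto
  then have i: "0 < ?i" "?i \<le> m * j" "m * j < k" "k \<le> m * n" using j k by auto
  have "l_law.prob {l \<in> space (pa_l_law m n w). l k \<in> pa_interval m n w j}
      = measure (density lborel (pa_end_density (R k))) {R ?i<..R (m * j)}"
    using i by (subst prob_end_in) (auto simp: pa_interval_def)
  also have "\<dots> \<le> (R (m * j) - R ?i) / (2 * sqrt (R k * R ?i))"
    using i by (intro measure_pa_end_density_Ioc R_pos iffD2[OF R_le_iff]) linarith+
  also have "\<dots> = pa_width m w j / (2 * sqrt (W k * W ?i))"
    unfolding pa_width_def using i by (intro R_diff_div_sqrt_eq) linarith+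
  finally show ?thesis .
qed

lemma card_pa_late_ends_Chernoff:
  assumes j: "2 \<le> j" and z: "1 < z"
  shows "emeasure (pa_l_law m n w)
             {l \<in> space (pa_l_law m n w). t \<le> real (card (pa_late_ends m n w l j))}
           \<le> ennreal (exp ((z - 1) * pa_late_mean_bound m n w j - t * ln z))"
  unfolding pa_late_ends_def pa_late_mean_bound_def
proof (rule l_law.Chernoff_card_indep_vars_ge)
  show "l_law.indep_vars (\<lambda>k. density lborel (pa_end_density (R k))) (\<lambda>k l. l k) {m * j + 1..m * n}"
    by (rule l_law.indep_vars_subset[OF indep_ends]) simp
  show "l_law.prob {l \<in> space (pa_l_law m n w). l k \<in> pa_interval m n w j}
      \<le> pa_width m w j / (2 * sqrt (W k * W (m * (j - 1))))" if "k \<in> {m * j + 1..m * n}" for k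
    using j that by (rule prob_late_end_le)
qed (simp_all add: pa_interval_def z)

lemma sets_card_pa_late_ends_ge:
  "{l \<in> space (pa_l_law m n w). t \<le> real (card (pa_late_ends m n w l j))} \<in> sets (pa_l_law m n w)"
proof -
  have [measurable]: "(\<lambda>l. l k) \<in> borel_measurable (pa_l_law m n w)"
    if "k \<in> {m * j + 1..m * n}" for k
    using that unfolding pa_l_law_def by (intro measurable_PiM_component_rev) auto
  have card: "real (card (pa_late_ends m n w l j))
      = (\<Sum>k=m * j + 1..m * n. indicator (pa_interval m n w j) (l k))" for l
    by (simp add: pa_late_ends_def indicator_def sum.If_cases Int_def)
  have [measurable]: "pa_interval m n w j \<in> sets borel" by (simp add: pa_interval_def)
  show ?thesis unfolding card by measurable
qed

lemma emeasure_mg_degree_gt_le: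
  assumes j: "j \<in> {2..n}" and z: "1 < z"
  shows "emeasure (pa_l_law m n w)
             {l \<in> space (pa_l_law m n w). t < real (mg_degree (pa_graph m n w l) j)}
           \<le> ennreal (z ^ (2 * m) * exp ((z - 1) * pa_late_mean_bound m n w j - t * ln z))"
proof -
  let ?L = "pa_l_law m n w" and ?t = "t - real (2 * m)"
  have "emeasure ?L {l \<in> space ?L. t < real (mg_degree (pa_graph m n w l) j)}
      \<le> emeasure ?L {l \<in> space ?L. ?t \<le> real (card (pa_late_ends m n w l j))}"
  proof (rule emeasure_mono_AE[OF _ sets_card_pa_late_ends_ge])
    show "AE l in ?L. l \<in> {l \<in> space ?L. t < real (mg_degree (pa_graph m n w l) j)} \<longrightarrow>
        l \<in> {l \<in> space ?L. ?t \<le> real (card (pa_late_ends m n w l j))}"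
      using AE_ends
    proof eventually_elim
      case (elim l)
      then have "real (mg_degree (pa_graph m n w l) j)
          \<le> real (2 * m + card (pa_late_ends m n w l j))"
        using j by (intro of_nat_mono mg_degree_pa_graph_le) auto
      then show ?case by auto
    qed
  qed
  also have "\<dots> \<le> ennreal (exp ((z - 1) * pa_late_mean_bound m n w j - ?t * ln z))"
    using j z by (intro card_pa_late_ends_Chernoff) auto
  also have "(z - 1) * pa_late_mean_bound m n w j - ?t * ln z
      = real (2 * m) * ln z + ((z - 1) * pa_late_mean_bound m n w j - t * ln z)"
    by (simp add: algebra_simps)
  also have "exp \<dots> = z ^ (2 * m) * exp ((z - 1) * pa_late_mean_bound m n w j - t * ln z)"
    unfolding exp_add exp_of_nat_mult using z by simp
  finally show ?thesis .
qed

end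


section \<open>Degrees for regular gaps\<close>

definition pa_degree_scale :: "nat \<Rightarrow> nat \<Rightarrow> real" where
  "pa_degree_scale n j = (sqrt (real n / real j) - 1) * ln (real n)"

text \<open>
  Equals \<open>poisson_rate z\<close> at \<open>\<epsilon> = 0\<close>; the factor \<open>(1 + \<epsilon>) / (1 - \<epsilon>)\<^sup>2\<close> is what regular gaps lose in
  the conditional mean.
\<close>

definition pa_tail_exponent :: "real \<Rightarrow> real \<Rightarrow> real" where
  "pa_tail_exponent \<epsilon> z = z * ln z - (1 + \<epsilon>) / (1 - \<epsilon>)\<^sup>2 * (z - 1)"

lemma sum_inverse_sqrt_le:
  assumes "a \<le> b"
  shows "(\<Sum>k=a+1..b. 1 / sqrt (real k)) \<le> 2 * (sqrt (real b) - sqrt (real a))"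
  using assms
proof (induction b rule: dec_induct)
  case (step b)
  have "sqrt (real b) * sqrt (real (Suc b)) \<le> (real b + real (Suc b)) / 2"
    using arith_geo_mean_sqrt[of "real b" "real (Suc b)"] by (simp add: real_sqrt_mult)
  then have "1 / sqrt (real (Suc b)) \<le> 2 * (sqrt (real (Suc b)) - sqrt (real b))"
    by (simp add: field_simps)
  with step show ?case by simp
qed simp

lemma pa_late_mean_bound_le:
  fixes c d :: real
  assumes m: "1 \<le> m" and j: "2 \<le> j" "j \<le> n" and c: "0 < c" and d: "0 \<le> d" "pa_width m w j \<le> d"
    and W: "\<And>k. k \<in> {m * (j - 1)..m * n} \<Longrightarrow> c * real k \<le> pa_W w k"
  shows "pa_late_mean_bound m n w j
           \<le> d / c * ((sqrt (real n) - sqrt (real j)) / sqrt (real (j - 1)))"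
proof -
  define i where "i = m * (j - 1)"
  have i: "0 < i" "i \<le> m * j" "m * j \<le> m * n" using m j by (auto simp: i_def)
  have summand: "pa_width m w j / (2 * sqrt (pa_W w k * pa_W w i))
      \<le> d / (2 * c * sqrt (real i)) * (1 / sqrt (real k))" if k: "k \<in> {m * j + 1..m * n}" for k
  proof -
    have k_i: "0 < k" "k \<in> {i..m * n}" "i \<in> {i..m * n}" using k i by auto
    then have "c * real k \<le> pa_W w k" "c * real i \<le> pa_W w i"
      by (simp_all only: W i_def)
    moreover have "0 \<le> c * real k" "0 \<le> c * real i" using c by simp_all
    ultimately have "(c * real k) * (c * real i) \<le> pa_W w k * pa_W w i"
      by (intro mult_mono) linarith+
    then have "sqrt ((c * real k) * (c * real i)) \<le> sqrt (pa_W w k * pa_W w i)" by simp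
    moreover have "sqrt ((c * real k) * (c * real i)) = c * (sqrt (real k) * sqrt (real i))"
      using c by (simp add: real_sqrt_mult)
    ultimately have "pa_width m w j / (2 * sqrt (pa_W w k * pa_W w i))
        \<le> d / (2 * (c * (sqrt (real k) * sqrt (real i))))"
      using c d k_i i by (intro frac_le) auto
    then show ?thesis by (simp add: mult_ac)
  qed
  have "pa_late_mean_bound m n w j
      \<le> d / (2 * c * sqrt (real i)) * (\<Sum>k=m * j + 1..m * n. 1 / sqrt (real k))"
    unfolding pa_late_mean_bound_def i_def[symmetric] sum_distrib_left
    by (rule sum_mono[OF summand])
  also have "\<dots> \<le> d / (2 * c * sqrt (real i)) * (2 * (sqrt (real (m * n)) - sqrt (real (m * j))))"
    using c d i by (intro mult_left_mono sum_inverse_sqrt_le) auto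
  also have "\<dots> = d / c * ((sqrt (real n) - sqrt (real j)) / sqrt (real (j - 1)))"
    using m by (simp add: i_def real_sqrt_mult flip: right_diff_distrib)
  finally show ?thesis .
qed

lemma sqrt_diff_div_sqrt_pred_le:
  assumes \<epsilon>: "\<epsilon> \<in> {0<..<1}" and j: "1 \<le> \<epsilon> * real j" "j \<le> n"
  shows "(sqrt (real n) - sqrt (real j)) / sqrt (real (j - 1))
           \<le> (sqrt (real n / real j) - 1) / (1 - \<epsilon>)"
proof -
  have j0: "0 < j" using j(1) by (cases j) auto
  have "(1 - \<epsilon>)\<^sup>2 * real j \<le> (1 - \<epsilon>) * real j"
    using \<epsilon> by (simp add: power2_eq_square mult_right_mono)
  also have "\<dots> \<le> real (j - 1)" using j j0 by (simp add: algebra_simps of_nat_diff)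
  finally have "sqrt ((1 - \<epsilon>)\<^sup>2 * real j) \<le> sqrt (real (j - 1))" by simp
  then have "(1 - \<epsilon>) * sqrt (real j) \<le> sqrt (real (j - 1))"
    using \<epsilon> by (simp add: real_sqrt_mult)
  then have "(sqrt (real n) - sqrt (real j)) / sqrt (real (j - 1))
      \<le> (sqrt (real n) - sqrt (real j)) / ((1 - \<epsilon>) * sqrt (real j))"
    using \<epsilon> j j0 by (intro frac_le) auto
  also have "\<dots> = (sqrt (real n / real j) - 1) / (1 - \<epsilon>)"
    using j0 \<epsilon> by (simp add: real_sqrt_divide field_simps)
  finally show ?thesis .
qed

lemma pa_level_le_pa_degree_scale:
  assumes \<sigma>: "\<sigma> \<in> {0<..<1}" and j: "1 \<le> j" "real j \<le> (1 - \<sigma>) * real n"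
  shows "pa_level \<sigma> * ln (real n) \<le> pa_degree_scale n j"
proof -
  have n: "0 < n" using j by (cases n) auto
  have "1 / (1 - \<sigma>) \<le> real n / real j" using \<sigma> j by (simp add: field_simps)
  then have "sqrt (1 / (1 - \<sigma>)) \<le> sqrt (real n / real j)" by simp
  moreover have "(1 - \<sigma>) powr (-1/2) = sqrt (1 / (1 - \<sigma>))"
    using powr_minus[of "1 - \<sigma>" "1/2"] powr_half_sqrt[of "1 - \<sigma>"] \<sigma>
    by (simp add: real_sqrt_divide inverse_eq_divide)
  ultimately show ?thesis
    unfolding pa_degree_scale_def pa_level_def using n by (intro mult_right_mono) auto
qed

definition pa_vertex_range :: "real \<Rightarrow> nat \<Rightarrow> nat \<Rightarrow> nat set" where
  "pa_vertex_range \<sigma> n j\<^sub>0 = {j. j\<^sub>0 \<le> j \<and> real j \<le> (1 - \<sigma>) * real n}"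

lemma pa_vertex_range_subset: "\<sigma> \<in> {0<..<1} \<Longrightarrow> pa_vertex_range \<sigma> n j\<^sub>0 \<subseteq> {j\<^sub>0..n}"
proof
  fix j
  assume \<sigma>: "\<sigma> \<in> {0<..<1}" and j: "j \<in> pa_vertex_range \<sigma> n j\<^sub>0"
  have "(1 - \<sigma>) * real n \<le> 1 * real n" using \<sigma> by (intro mult_right_mono) auto
  with j show "j \<in> {j\<^sub>0..n}" by (simp add: pa_vertex_range_def)
qed

lemma Pair_in_space_pa_space:
  "(w, l) \<in> space (pa_space m n) \<longleftrightarrow> w \<in> space (pa_w_law m n) \<and> l \<in> space (pa_l_law m n w)"
  using sets_eq_imp_space_eq[OF sets_pa_space, of m n]
    sets_eq_imp_space_eq[OF sets_pa_w_law, of m n]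
    sets_eq_imp_space_eq[OF sets_pa_l_law, of m n w]
  by (simp add: space_pair_measure)

lemma sets_mg_degree_gt_section:
  assumes "w \<in> space (pa_w_law m n)"
  shows "{l \<in> space (pa_l_law m n w). t < real (mg_degree (pa_graph m n w l) j)}
           \<in> sets (pa_l_law m n w)"
proof -
  have "{\<omega> \<in> space (pa_space m n). t < real (mg_degree (pa_graph m n (fst \<omega>) (snd \<omega>)) j)}
      \<in> sets (pa_space m n)"
    by measurable
  from sets_Pair1[OF this[unfolded sets_pa_space], of w] show ?thesis
    using assms by (simp add: vimage_def Pair_in_space_pa_space)
qed

locale pa_regular_gaps = pa_positive_gaps +
  fixes \<epsilon> :: real and j\<^sub>0 :: nat
  assumes m_ge_1: "1 \<le> m" and \<epsilon>: "\<epsilon> \<in> {0<..<1}" and j\<^sub>0: "2 \<le> j\<^sub>0" "1 \<le> \<epsilon> * real j\<^sub>0"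
    and W_ge: "k \<in> {m * (j\<^sub>0 - 1)..m * n} \<Longrightarrow> (1 - \<epsilon>) * real k \<le> W k"
    and width_le: "j \<in> {1..n} \<Longrightarrow> pa_width m w j \<le> (1 + \<epsilon>) * ln (real n)"
begin

lemma pa_late_mean_bound_le_scale:
  assumes j: "j \<in> {j\<^sub>0..n}"
  shows "pa_late_mean_bound m n w j \<le> (1 + \<epsilon>) / (1 - \<epsilon>)\<^sup>2 * pa_degree_scale n j"
proof -
  let ?d = "(1 + \<epsilon>) * ln (real n)"
  have d: "0 \<le> ?d" using \<epsilon> j j\<^sub>0 by simp
  have "\<epsilon> * real j\<^sub>0 \<le> \<epsilon> * real j" using j \<epsilon> by simp
  then have \<epsilon>j: "1 \<le> \<epsilon> * real j" using j\<^sub>0 by linarith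
  have W: "(1 - \<epsilon>) * real k \<le> W k" if "k \<in> {m * (j - 1)..m * n}" for k
  proof (rule W_ge)
    have "m * (j\<^sub>0 - 1) \<le> m * (j - 1)" using j by (intro mult_le_mono2) auto
    with that show "k \<in> {m * (j\<^sub>0 - 1)..m * n}" unfolding atLeastAtMost_iff by linarith
  qed
  have "pa_late_mean_bound m n w j
      \<le> ?d / (1 - \<epsilon>) * ((sqrt (real n) - sqrt (real j)) / sqrt (real (j - 1)))"
    using m_ge_1 j j\<^sub>0 \<epsilon> d width_le W by (intro pa_late_mean_bound_le) auto
  also have "\<dots> \<le> ?d / (1 - \<epsilon>) * ((sqrt (real n / real j) - 1) / (1 - \<epsilon>))"
    using d \<epsilon> \<epsilon>j j by (intro mult_left_mono sqrt_diff_div_sqrt_pred_le) auto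
  also have "\<dots> = (1 + \<epsilon>) / (1 - \<epsilon>)\<^sup>2 * pa_degree_scale n j"
    by (simp add: pa_degree_scale_def power2_eq_square)
  finally show ?thesis .
qed

lemma emeasure_degree_exceeds_le:
  assumes j: "j \<in> {j\<^sub>0..n}" and z: "1 < z"
  shows "emeasure (pa_l_law m n w) {l \<in> space (pa_l_law m n w).
             z * pa_degree_scale n j < real (mg_degree (pa_graph m n w l) j)}
           \<le> ennreal (z ^ (2 * m) * exp (- pa_tail_exponent \<epsilon> z * pa_degree_scale n j))"
proof -
  let ?s = "pa_degree_scale n j" and ?\<mu> = "pa_late_mean_bound m n w j"
  have "(z - 1) * ?\<mu> \<le> (z - 1) * ((1 + \<epsilon>) / (1 - \<epsilon>)\<^sup>2 * ?s)"
    using z pa_late_mean_bound_le_scale[OF j] by (intro mult_left_mono) auto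
  then have "(z - 1) * ?\<mu> - z * ?s * ln z \<le> - pa_tail_exponent \<epsilon> z * ?s"
    by (simp add: pa_tail_exponent_def algebra_simps)
  then have "z ^ (2 * m) * exp ((z - 1) * ?\<mu> - z * ?s * ln z)
      \<le> z ^ (2 * m) * exp (- pa_tail_exponent \<epsilon> z * ?s)"
    using z by (intro mult_left_mono) auto
  moreover have "j \<in> {2..n}" using j j\<^sub>0 by simp
  ultimately show ?thesis
    using emeasure_mg_degree_gt_le[of j z "z * ?s"] z by (meson ennreal_leI order_trans)
qed

lemma emeasure_degree_exceeds_le_powr:
  assumes \<sigma>: "\<sigma> \<in> {0<..<1}" and j: "j \<in> pa_vertex_range \<sigma> n j\<^sub>0"
    and z: "1 < z" and exponent: "0 \<le> pa_tail_exponent \<epsilon> z"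
  shows "emeasure (pa_l_law m n w) {l \<in> space (pa_l_law m n w).
             z * pa_degree_scale n j < real (mg_degree (pa_graph m n w l) j)}
           \<le> ennreal (z ^ (2 * m) * real n powr (- (pa_level \<sigma> * pa_tail_exponent \<epsilon> z)))"
proof -
  let ?f = "pa_tail_exponent \<epsilon> z"
  have j': "j \<in> {j\<^sub>0..n}" using j pa_vertex_range_subset[OF \<sigma>] by blast
  have "pa_level \<sigma> * ln (real n) \<le> pa_degree_scale n j"
    using \<sigma> j j\<^sub>0 by (intro pa_level_le_pa_degree_scale) (auto simp: pa_vertex_range_def)
  then have "- ?f * pa_degree_scale n j \<le> - ?f * (pa_level \<sigma> * ln (real n))"
    using exponent by (intro mult_left_mono_neg) auto
  then have "exp (- ?f * pa_degree_scale n j) \<le> exp (- ?f * (pa_level \<sigma> * ln (real n)))"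
    by simp
  also have "\<dots> = real n powr (- (pa_level \<sigma> * ?f))"
    using j' j\<^sub>0 by (simp add: powr_def mult_ac)
  finally have "z ^ (2 * m) * exp (- ?f * pa_degree_scale n j)
      \<le> z ^ (2 * m) * real n powr (- (pa_level \<sigma> * ?f))"
    using z by (intro mult_left_mono) auto
  then show ?thesis
    using emeasure_degree_exceeds_le[OF j' z] by (meson ennreal_leI order_trans)
qed

lemma emeasure_some_degree_exceeds_le:
  assumes w: "w \<in> space (pa_w_law m n)" and \<sigma>: "\<sigma> \<in> {0<..<1}"
    and z: "1 < z" and exponent: "0 \<le> pa_tail_exponent \<epsilon> z"
  shows "emeasure (pa_l_law m n w) {l \<in> space (pa_l_law m n w). \<exists>j\<in>pa_vertex_range \<sigma> n j\<^sub>0.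
             z * pa_degree_scale n j < real (mg_degree (pa_graph m n w l) j)}
           \<le> ennreal (z ^ (2 * m) * real n powr (1 - pa_level \<sigma> * pa_tail_exponent \<epsilon> z))"
proof -
  let ?J = "pa_vertex_range \<sigma> n j\<^sub>0" and ?f = "pa_tail_exponent \<epsilon> z"
  define b where "b = z ^ (2 * m) * real n powr (- (pa_level \<sigma> * ?f))"
  have b: "0 \<le> b" using z by (simp add: b_def)
  have J: "?J \<subseteq> {1..n}" using pa_vertex_range_subset[OF \<sigma>, of n j\<^sub>0] j\<^sub>0 by fastforce
  have "emeasure (pa_l_law m n w) {l \<in> space (pa_l_law m n w). \<exists>j\<in>?J.
      z * pa_degree_scale n j < real (mg_degree (pa_graph m n w l) j)} \<le> ennreal (\<Sum>j\<in>?J. b)"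
    using J b w z \<sigma> exponent unfolding b_def
    by (intro emeasure_Bex_le_sum sets_mg_degree_gt_section emeasure_degree_exceeds_le_powr)
       (auto intro: finite_subset)
  also have "(\<Sum>j\<in>?J. b) \<le> real n * b"
    using card_mono[OF _ J] b by (simp add: mult_right_mono)
  also have "real n * b = z ^ (2 * m) * real n powr (1 - pa_level \<sigma> * ?f)"
    using powr_mult_base[of "real n" "- (pa_level \<sigma> * ?f)"] by (simp add: b_def)
  finally show ?thesis by (simp add: ennreal_leI)
qed

end

section \<open>All degrees with high probability\<close>

definition pa_exceeding :: "nat \<Rightarrow> nat \<Rightarrow> real \<Rightarrow> real \<Rightarrow> nat \<Rightarrow> ((nat \<Rightarrow> real) \<times> (nat \<Rightarrow> real)) set" where
  "pa_exceeding m n \<sigma> z j\<^sub>0 = {\<omega> \<in> space (pa_space m n). \<exists>j\<in>pa_vertex_range \<sigma> n j\<^sub>0.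
     z * pa_degree_scale n j < real (mg_degree (pa_graph m n (fst \<omega>) (snd \<omega>)) j)}"

lemma sets_pa_exceeding:
  assumes "\<sigma> \<in> {0<..<1}"
  shows "pa_exceeding m n \<sigma> z j\<^sub>0 \<in> sets (pa_space m n)"
proof -
  have "finite (pa_vertex_range \<sigma> n j\<^sub>0)"
    using pa_vertex_range_subset[OF assms] by (rule finite_subset) simp
  then show ?thesis
    unfolding pa_exceeding_def by (intro sets.sets_Collect_finite_Ex) measurable
qed

lemma emeasure_pa_space:
  assumes "B \<in> sets (pa_space m n)"
  shows "emeasure (pa_space m n) B = (\<integral>\<^sup>+w. emeasure (pa_l_law m n w) (Pair w -` B) \<partial>pa_w_law m n)"
proof -
  have P: "sets (pa_w_law m n \<Otimes>\<^sub>M pa_l_space m n) = sets (pa_w_space m n \<Otimes>\<^sub>M pa_l_space m n)"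
    by (intro sets_pair_measure_cong) simp_all
  have "pa_l_law m n \<in> measurable (pa_w_law m n) (subprob_algebra (pa_l_space m n))"
    by measurable
  from emeasure_bind_return_pair[OF this pa_w_law.not_empty] show ?thesis
    using assms unfolding P return_sets_cong[OF P] pa_space_def[symmetric] by simp
qed

lemma emeasure_pa_exceeding_le:
  assumes m: "1 \<le> m" and \<epsilon>: "\<epsilon> \<in> {0<..<1}" and \<sigma>: "\<sigma> \<in> {0<..<1}" and z: "1 < z"
    and exponent: "0 \<le> pa_tail_exponent \<epsilon> z"
    and j\<^sub>0: "2 \<le> j\<^sub>0" "1 \<le> \<epsilon> * real j\<^sub>0"
  shows "emeasure (pa_space m n) (pa_exceeding m n \<sigma> z j\<^sub>0)
           \<le> emeasure (pa_w_law m n) (pa_small_W m n \<epsilon> (m * (j\<^sub>0 - 1)))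
             + emeasure (pa_w_law m n) (pa_wide m n ((1 + \<epsilon>) * ln (real n)))
             + ennreal (z ^ (2 * m) * real n powr (1 - pa_level \<sigma> * pa_tail_exponent \<epsilon> z))"
proof -
  let ?A = "pa_small_W m n \<epsilon> (m * (j\<^sub>0 - 1))" and ?B = "pa_wide m n ((1 + \<epsilon>) * ln (real n))"
    and ?b = "ennreal (z ^ (2 * m) * real n powr (1 - pa_level \<sigma> * pa_tail_exponent \<epsilon> z))"
  let ?p = "\<lambda>w. emeasure (pa_l_law m n w) (Pair w -` pa_exceeding m n \<sigma> z j\<^sub>0)"
  have "emeasure (pa_space m n) (pa_exceeding m n \<sigma> z j\<^sub>0) = (\<integral>\<^sup>+w. ?p w \<partial>pa_w_law m n)"
    by (rule emeasure_pa_space[OF sets_pa_exceeding[OF \<sigma>]])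
  also have "\<dots> \<le> emeasure (pa_w_law m n) (?A \<union> ?B) + ?b"
  proof (rule pa_w_law.nn_integral_le_emeasure_plus)
    show "AE w in pa_w_law m n. ?p w \<le> 1"
      by (intro AE_I2 subprob_space.subprob_emeasure_le_1 subprob_space_pa_l_law)
    show "AE w in pa_w_law m n. w \<notin> ?A \<union> ?B \<longrightarrow> ?p w \<le> ?b"
      using AE_pa_w_law_pos AE_space
    proof eventually_elim
      case (elim w)
      show ?case
      proof
        assume regular: "w \<notin> ?A \<union> ?B"
        interpret pa_positive_gaps m n w using elim(1) by unfold_locales simp
        interpret pa_regular_gaps m n w \<epsilon> j\<^sub>0
          using regular elim(2) m \<epsilon> j\<^sub>0
          by unfold_locales (force simp: pa_small_W_def pa_wide_def)+
        have "Pair w -` pa_exceeding m n \<sigma> z j\<^sub>0 = {l \<in> space (pa_l_law m n w).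
            \<exists>j\<in>pa_vertex_range \<sigma> n j\<^sub>0.
              z * pa_degree_scale n j < real (mg_degree (pa_graph m n w l) j)}"
          using elim(2) by (auto simp: pa_exceeding_def Pair_in_space_pa_space)
        then show "?p w \<le> ?b"
          using emeasure_some_degree_exceeds_le[OF elim(2) \<sigma> z exponent] by simp
      qed
    qed
  qed (intro sets.Un sets_pa_small_W sets_pa_wide)
  also have "\<dots> \<le> emeasure (pa_w_law m n) ?A + emeasure (pa_w_law m n) ?B + ?b"
    by (intro add_right_mono emeasure_subadditive sets_pa_small_W sets_pa_wide)
  finally show ?thesis .
qed

lemma measure_pa_exceeding_le:
  fixes \<epsilon> \<sigma> z :: real
  defines "q \<equiv> (1 - \<epsilon>) * exp \<epsilon>"
  assumes m: "1 \<le> m" and \<epsilon>: "\<epsilon> \<in> {0<..<1}" and \<sigma>: "\<sigma> \<in> {0<..<1}" and z: "1 < z"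
    and exponent: "0 \<le> pa_tail_exponent \<epsilon> z"
    and j\<^sub>0: "2 \<le> j\<^sub>0" "1 \<le> \<epsilon> * real j\<^sub>0" and n: "1 \<le> n"
  shows "measure (pa_space m n) (pa_exceeding m n \<sigma> z j\<^sub>0)
           \<le> q ^ (m * (j\<^sub>0 - 1)) / (1 - q) + (2 * (1 + \<epsilon>) / \<epsilon>) ^ m * real n powr (- \<epsilon> / 2)
             + z ^ (2 * m) * real n powr (1 - pa_level \<sigma> * pa_tail_exponent \<epsilon> z)"
    (is "_ \<le> ?a + ?b + ?c")
proof -
  have nonneg: "0 \<le> ?a" "0 \<le> ?b" "0 \<le> ?c"
    using \<epsilon> z one_minus_mult_exp_less_1[of \<epsilon>] by (auto simp: q_def)
  note emeasure_pa_exceeding_le[OF m \<epsilon> \<sigma> z exponent j\<^sub>0, of n]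
  also have "emeasure (pa_w_law m n) (pa_small_W m n \<epsilon> (m * (j\<^sub>0 - 1)))
      + emeasure (pa_w_law m n) (pa_wide m n ((1 + \<epsilon>) * ln (real n))) + ennreal ?c
      \<le> ennreal ?a + ennreal ?b + ennreal ?c"
    unfolding q_def using \<epsilon> n
    by (intro add_right_mono add_mono emeasure_pa_small_W_le emeasure_pa_wide_log_le) auto
  also have "\<dots> = ennreal (?a + ?b + ?c)"
    using nonneg by (simp flip: ennreal_plus)
  finally show ?thesis
    unfolding measure_def using nonneg by (intro enn2real_leI) auto
qed

lemma ex_pa_tail_exponent:
  assumes \<sigma>: "\<sigma> \<in> {0<..<1}" and z: "pa_root \<sigma> < z"
  obtains \<epsilon> where "\<epsilon> \<in> {0<..<1}" "1 < pa_level \<sigma> * pa_tail_exponent \<epsilon> z"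
proof -
  have "inverse (pa_level \<sigma>) < poisson_rate z"
    using \<sigma> z pa_root_gt_1[OF \<sigma>] poisson_rate_less_iff[of "pa_root \<sigma>" z]
    by (simp flip: poisson_rate_pa_root)
  then have "1 < pa_level \<sigma> * pa_tail_exponent 0 z"
    using pa_level_pos[OF \<sigma>] by (simp add: poisson_rate_def pa_tail_exponent_def field_simps)
  moreover have "((\<lambda>\<epsilon>. pa_level \<sigma> * pa_tail_exponent \<epsilon> z)
      \<longlongrightarrow> pa_level \<sigma> * pa_tail_exponent 0 z) (at_right 0)"
    unfolding pa_tail_exponent_def by (intro tendsto_intros) auto
  ultimately have "\<forall>\<^sub>F \<epsilon> in at_right 0. 1 < pa_level \<sigma> * pa_tail_exponent \<epsilon> z"
    by (simp add: order_tendstoD)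
  with eventually_at_right_unit_interval
  have "\<forall>\<^sub>F \<epsilon> in at_right 0. \<epsilon> \<in> {0<..<1} \<and> 1 < pa_level \<sigma> * pa_tail_exponent \<epsilon> z"
    by (rule eventually_conj)
  from eventually_happens'[OF trivial_limit_at_right_real this] that show ?thesis by blast
qed

lemma pa_exceeding_tendsto_0:
  assumes m: "1 \<le> m" and \<sigma>: "\<sigma> \<in> {0<..<1}" and z: "pa_root \<sigma> < z"
    and j\<^sub>0: "filterlim j\<^sub>0 at_top sequentially"
  shows "(\<lambda>n. measure (pa_space m n) (pa_exceeding m n \<sigma> z (j\<^sub>0 n))) \<longlonglongrightarrow> 0"
proof -
  obtain \<epsilon> where \<epsilon>: "\<epsilon> \<in> {0<..<1}" and exponent: "1 < pa_level \<sigma> * pa_tail_exponent \<epsilon> z"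
    using ex_pa_tail_exponent[OF \<sigma> z] .
  define q where "q = (1 - \<epsilon>) * exp \<epsilon>"
  define b where "b n = q ^ (m * (j\<^sub>0 n - 1)) / (1 - q)
      + (2 * (1 + \<epsilon>) / \<epsilon>) ^ m * real n powr (- \<epsilon> / 2)
      + z ^ (2 * m) * real n powr (1 - pa_level \<sigma> * pa_tail_exponent \<epsilon> z)" for n
  have q: "\<bar>q\<bar> < 1" using one_minus_mult_exp_less_1[of \<epsilon>] \<epsilon> by (simp add: q_def)
  have z1: "1 < z" using pa_root_gt_1[OF \<sigma>] z by simp
  have exponent_nonneg: "0 \<le> pa_tail_exponent \<epsilon> z"
    using exponent pa_level_pos[OF \<sigma>]
      zero_less_mult_pos[of "pa_level \<sigma>" "pa_tail_exponent \<epsilon> z"] by simp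
  have "filterlim (\<lambda>n. m * (j\<^sub>0 n - 1)) at_top sequentially"
  proof (rule filterlim_at_top_mono)
    show "filterlim (\<lambda>n. j\<^sub>0 n - 1) at_top sequentially"
      by (rule filterlim_compose[OF filterlim_minus_const_nat_at_top j\<^sub>0])
  qed (use m in simp)
  then have "(\<lambda>n. q ^ (m * (j\<^sub>0 n - 1))) \<longlonglongrightarrow> 0"
    using q by (intro filterlim_compose[OF LIMSEQ_power_zero]) auto
  moreover have "(\<lambda>n. real n powr (- \<epsilon> / 2)) \<longlonglongrightarrow> 0"
    "(\<lambda>n. real n powr (1 - pa_level \<sigma> * pa_tail_exponent \<epsilon> z)) \<longlonglongrightarrow> 0"
    using \<epsilon> exponent by (auto intro!: tendsto_neg_powr filterlim_real_sequentially)
  ultimately have "b \<longlonglongrightarrow> 0 / (1 - q) + (2 * (1 + \<epsilon>) / \<epsilon>) ^ m * 0 + z ^ (2 * m) * 0"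
    unfolding b_def using q by (intro tendsto_intros) auto
  then have b_0: "b \<longlonglongrightarrow> 0" by simp
  have b: "\<forall>\<^sub>F n in sequentially. measure (pa_space m n) (pa_exceeding m n \<sigma> z (j\<^sub>0 n)) \<le> b n"
    using eventually_ge_at_top[of 1] filterlim_at_top[THEN iffD1, OF j\<^sub>0, rule_format, of 2]
      filterlim_at_top[THEN iffD1, OF j\<^sub>0, rule_format, of "nat \<lceil>1 / \<epsilon>\<rceil>"]
  proof eventually_elim
    case (elim n)
    have "1 / \<epsilon> \<le> real (j\<^sub>0 n)" using elim(3) by linarith
    then have "1 \<le> \<epsilon> * real (j\<^sub>0 n)" using \<epsilon> by (simp add: field_simps)
    then show ?case
      unfolding b_def q_def using m \<epsilon> \<sigma> z1 exponent_nonneg elim by (intro measure_pa_exceeding_le)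
  qed
  show ?thesis
    by (rule tendsto_sandwich[OF _ b tendsto_const b_0]) simp
qed

lemma filterlim_nat_floor_powr_at_top:
  assumes "0 < a"
  shows "filterlim (\<lambda>n. nat \<lfloor>real n powr a\<rfloor>) at_top sequentially"
proof -
  have "filterlim (\<lambda>n. \<lfloor>real n powr a\<rfloor>) at_top sequentially"
    using assms by (intro filterlim_compose[OF filterlim_floor_sequentially]) real_asymp
  then show ?thesis by (rule filterlim_compose[OF filterlim_nat_sequentially])
qed

lemma measure_pa_not_exceeding:
  assumes "\<sigma> \<in> {0<..<1}"
  shows "measure (pa_space m n) {(w, l) \<in> space (pa_space m n).
             \<forall>j. j\<^sub>0 \<le> j \<and> real j \<le> (1 - \<sigma>) * real n \<longrightarrow>
               real (mg_degree (pa_graph m n w l) j)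
                 \<le> z * (sqrt (real n / real j) - 1) * ln (real n)}
           = 1 - measure (pa_space m n) (pa_exceeding m n \<sigma> z j\<^sub>0)"
  unfolding pa_space.prob_compl[OF sets_pa_exceeding[OF assms], symmetric]
  by (intro arg_cong[where f = "measure (pa_space m n)"])
     (auto simp: pa_exceeding_def pa_vertex_range_def pa_degree_scale_def not_less mult.assoc)

theorem theorem2p3:
  fixes m :: nat and a :: real
  assumes "m \<ge> 1" and "0 < a" and "a < real m / (real m + 2)"
  shows "(\<forall>\<sigma>\<in>{0<..<1}. \<exists>!z. pa_is_root \<sigma> z)
    \<and> pa_root \<sim>[at_right 0] (\<lambda>\<sigma>. 2 * inverse (\<sigma> * ln (1 / \<sigma>)))
    \<and> (\<forall>\<sigma>\<in>{0<..<1}. \<forall>z. z > pa_root \<sigma> \<longrightarrow>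
         (\<lambda>n. measure (pa_space m n)
                {(w, l) \<in> space (pa_space m n).
                   \<forall>j. nat \<lfloor>real n powr a\<rfloor> \<le> j \<and> real j \<le> (1 - \<sigma>) * real n \<longrightarrow>
                     real (mg_degree (pa_graph m n w l) j)
                       \<le> z * (sqrt (real n / real j) - 1) * ln (real n)})
         \<longlonglongrightarrow> 1)"
proof (intro conjI ballI allI impI)
  show "\<exists>!z. pa_is_root \<sigma> z" if "\<sigma> \<in> {0<..<1}" for \<sigma>
    using that by (rule pa_root_ex1)
  show "pa_root \<sim>[at_right 0] (\<lambda>\<sigma>. 2 * inverse (\<sigma> * ln (1 / \<sigma>)))"
    by (rule pa_root_asymp_equiv)
  fix \<sigma> z :: real
  assume \<sigma>: "\<sigma> \<in> {0<..<1}" and z: "z > pa_root \<sigma>"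
  have "(\<lambda>n. 1 - measure (pa_space m n) (pa_exceeding m n \<sigma> z (nat \<lfloor>real n powr a\<rfloor>))) \<longlonglongrightarrow> 1 - 0"
    using assms \<sigma> z
    by (intro tendsto_diff tendsto_const pa_exceeding_tendsto_0 filterlim_nat_floor_powr_at_top)
  then show "(\<lambda>n. measure (pa_space m n)
                {(w, l) \<in> space (pa_space m n).
                   \<forall>j. nat \<lfloor>real n powr a\<rfloor> \<le> j \<and> real j \<le> (1 - \<sigma>) * real n \<longrightarrow>
                     real (mg_degree (pa_graph m n w l) j)
                       \<le> z * (sqrt (real n / real j) - 1) * ln (real n)})
         \<longlonglongrightarrow> 1"
    by (simp add: measure_pa_not_exceeding[OF \<sigma>])
qed

end
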